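(* Let $R$ be an aperiodic random walk on $\mathbb{Z}$ with step $\xi$ satisfying $\mathbb{E}|\xi|^3<\infty$ and $\mathbb{E}\xi=0$, and let $(A_n)$ be the DLA process with respect to $R$, $D_n=\operatorname{diam}A_n$. Then there is some constant $C$ such that almost surely $\limsup_{n\to\infty}\frac{D_n}{n}<C$.
   Context: $R=(R_0,R_1,\dots)$ is a random walk on $\mathbb{Z}$ with i.i.d. steps distributed as an integer-valued variable $\xi$; $\mathbb{P}_x$ is its law started at $x$, and $p_{x,y}=\mathbb{P}(\xi=y-x)$. The walk is aperiodic if for all $x,y\in\mathbb{Z}$ there is $n$ with $\mathbb{P}_x(R_n=y)\ne0$. For $A\subset\mathbb{Z}$, $T_A=\min\{n>0:R_n\in A\}$, and $T_x=T_{\{x\}}$. $\operatorname{diam}A=\max A-\min A$. (The walks considered here are recurrent.) For $A\subset\mathbb{Z}$ finite nonempty, $x\notin A$, $a\in A$, the limits $\mathbb{P}_{\pm\infty}(T_x<T_A):=\lim_{y\to\pm\infty}\mathbb{P}_y(T_x<T_A)$ exist; put $\mathbb{P}_\infty(T_x<T_A)=\frac12\big(\mathbb{P}_{+\infty}(T_x<T_A)+\mathbb{P}_{-\infty}(T_x<T_A)\big)$ and define the gluing measure $$\mu(x,a;A)=\frac{p_{x,a}\,\mathbb{P}_\infty(T_x<T_A)}{\mathbb{P}_x(T_A<T_x)}.$$ The DLA process with respect to $R$ is the Markov chain of random finite sets $A_0=\{0\}\subset A_1\subset A_2\subset\cdots$ such that for all $n\ge0$, finite $A\subset\mathbb{Z}$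 and $x\in\mathbb{Z}\setminus A$, $\mathbb{P}(A_{n+1}=A\cup\{x\}\mid A_n=A)=\sum_{a\in A}\mu(x,a;A)$. *)

theory Defs
  imports "HOL-Probability.Probability"
begin

text \<open>The step distribution is given by its law, an \<open>int pmf\<close>. The measure \<open>walk_law p x\<close> is the law
  \<open>\<P>\<^sub>x\<close> of the whole trajectory \<open>(R\<^sub>0, R\<^sub>1, \<dots>)\<close> on path space.\<close>

definition walk_law :: "int pmf \<Rightarrow> int \<Rightarrow> (nat \<Rightarrow> int) measure" where
  "walk_law p x =
     distr (\<Pi>\<^sub>M i\<in>(UNIV :: nat set). measure_pmf p) (\<Pi>\<^sub>M i\<in>(UNIV :: nat set). count_space UNIV)
       (\<lambda>\<omega> n. x + (\<Sum>i<n. \<omega> i))"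

definition aperiodic_walk :: "int pmf \<Rightarrow> bool" where
  "aperiodic_walk p \<longleftrightarrow> (\<forall>x y. \<exists>n. \<P>(r in walk_law p x. r n = y) \<noteq> 0)"

text \<open>\<open>T\<^sub>A\<close>, with value \<open>\<infinity>\<close> (the infimum of the empty set) if \<open>A\<close> is never hit at a positive time.\<close>

definition hit_time :: "int set \<Rightarrow> (nat \<Rightarrow> int) \<Rightarrow> enat" where
  "hit_time A r = Inf (enat ` {n. 0 < n \<and> r n \<in> A})"

definition hit_before :: "int pmf \<Rightarrow> int \<Rightarrow> int set \<Rightarrow> int set \<Rightarrow> real" where
  "hit_before p y A B = \<P>(r in walk_law p y. hit_time A r < hit_time B r)"

definition hit_before_infinity :: "int pmf \<Rightarrow> int set \<Rightarrow> int set \<Rightarrow> real" where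
  "hit_before_infinity p A B =
     (Lim at_top (\<lambda>y. hit_before p y A B) + Lim at_bot (\<lambda>y. hit_before p y A B)) / 2"

definition gluing_measure :: "int pmf \<Rightarrow> int \<Rightarrow> int \<Rightarrow> int set \<Rightarrow> real" where
  "gluing_measure p x a A =
     pmf p (a - x) * hit_before_infinity p {x} A / hit_before p x A {x}"

text \<open>A Markov chain of random finite sets on \<open>M\<close>. As \<open>cond_prob\<close> takes the value 0 when the
  conditioning event is null, conditional probabilities are only prescribed for
  conditioning events of positive probability.\<close>

definition DLA_process :: "int pmf \<Rightarrow> 'w measure \<Rightarrow> (nat \<Rightarrow> 'w \<Rightarrow> int set) \<Rightarrow> bool" where
  "DLA_process p M A \<longleftrightarrow>
     prob_space M \<and>
     (\<forall>n. A n \<in> M \<rightarrow>\<^sub>M count_space {S. finite S}) \<and>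
     (AE \<omega> in M. A 0 \<omega> = {0}) \<and>
     (AE \<omega> in M. \<forall>n. A n \<omega> \<subseteq> A (Suc n) \<omega>) \<and>
     (\<forall>n S B. \<P>(\<omega> in M. \<forall>i\<le>n. A i \<omega> = S i) > 0 \<longrightarrow>
        \<P>(\<omega> in M. A (Suc n) \<omega> = B \<bar> \<forall>i\<le>n. A i \<omega> = S i) =
        \<P>(\<omega> in M. A (Suc n) \<omega> = B \<bar> A n \<omega> = S n)) \<and>
     (\<forall>n S x. finite S \<longrightarrow> x \<notin> S \<longrightarrow> \<P>(\<omega> in M. A n \<omega> = S) > 0 \<longrightarrow>
        \<P>(\<omega> in M. A (Suc n) \<omega> = S \<union> {x} \<bar> A n \<omega> = S) = (\<Sum>a\<in>S. gluing_measure p x a S))"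

definition diam :: "int set \<Rightarrow> int" where
  "diam A = Max A - Min A"

end

(* Let L be the generator of the walk. For bounded f choose F with second difference f; since the
   steps are centred with finite variance, LF is bounded, and its second difference is Lf. A bounded
   function on the integers whose second difference is nonnegative off a finite set has second
   differences of nonpositive sum over that set. Applied to f and f^2 this gives a Liouville theorem
   (hence recurrence and a maximum principle) and an energy bound for y |-> P_y(T_x < T_S), which by
   Cauchy-Schwarz along paths yields P_x(T_S < T_x) >= c / dist(x, S) and the vanishing of the
   increments of y |-> P_y(T_x < T_S). With a tight overshoot the limits at infinity exist, and
   dominated convergence in the decomposition of T_S by its last jump shows that the gluing measure
   has mass 1. A particle is thus glued at distance m from A_n with probability at most
   w(m) = O(m P(|xi| >= m)), uniformly in the past, and E|xi|^3 < oo makes w have finite mean.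
   Truncating the increments at N = 2^k, a second moment bound and Borel-Cantelli give linear growth. *)
theory Submission
  imports Defs "HOL-Library.Nat_Bijection"
begin

section \<open>The generator of a centred walk\<close>

text \<open>The walk need not be symmetric or nearest-neighbour, so neither direct summation by
  parts nor a site-by-site crossing argument is available. Everything about hitting probabilities
  comes from the nonpositive total of the generator of a bounded function; a probability is
  identified by exhibiting a function with the same generator and boundary values. Existence of the
  limits at infinity is no formality, since \<open>Lim\<close> carries information only once a limit
  exists. The total mass matters because the process prescribes only the probabilities of adding one
  new point: if they fell short of 1, the rest could go to uncontrolled jumps. The escape bound
  costs one factor m and the mean of the increments another, so the tail of the step is weighted by
  m^2, which is what a third moment makes summable. The increments are dominated, not independent,
  and the dominating weight may have infinite second moment, hence the truncation. Its cost, m^2 / N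
  up to level N and N above it, adds up to at most 4m over the scales N = 2^k, so a finite mean
  suffices.\<close>

lemma bounded_convex_right:
  fixes u :: "int \<Rightarrow> real"
  assumes bounded: "\<And>y. \<bar>u y\<bar> \<le> C"
    and convex: "\<And>y. b < y \<Longrightarrow> 0 \<le> u (y + 1) - 2 * u y + u (y - 1)"
  shows "u (b + 1) \<le> u b"
proof (rule ccontr)
  define \<delta> where "\<delta> = u (b + 1) - u b"
  assume "\<not> ?thesis"
  then have pos: "\<delta> > 0" by (simp add: \<delta>_def)
  \<comment> \<open>Convexity never lets the slope drop to the right of \<open>b\<close>, so a
    positive slope there forces linear growth.\<close>
  have slope: "u (b + int n + 1) - u (b + int n) \<ge> \<delta>" for n
  proof (induction n)
    case (Suc n)
    then show ?case using convex[of "b + int n + 1"] by (simp add: algebra_simps)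
  qed (simp add: \<delta>_def)
  have growth: "u (b + int n) \<ge> u b + real n * \<delta>" for n
  proof (induction n)
    case (Suc n)
    then show ?case using slope[of n] by (simp add: algebra_simps)
  qed simp
  obtain n where "real n * \<delta> > 2 * C" using pos ex_less_of_nat_mult by blast
  then show False using growth[of n] bounded[of b] bounded[of "b + int n"] by linarith
qed

text \<open>The sum telescopes to the slope at the right end minus the slope at the left end;
  boundedness makes the former nonpositive and, after reflection, the latter nonnegative.\<close>

lemma bounded_second_difference_sum:
  fixes u :: "int \<Rightarrow> real"
  assumes bounded: "\<And>y. \<bar>u y\<bar> \<le> C" and "a \<le> b"
    and convex: "\<And>y. y < a \<or> b < y \<Longrightarrow> 0 \<le> u (y + 1) - 2 * u y + u (y - 1)"
  shows "(\<Sum>y=a..b. u (y + 1) - 2 * u y + u (y - 1)) \<le> 0"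
proof -
  have right: "u (b + 1) \<le> u b"
    using bounded convex by (intro bounded_convex_right[of u C]) auto
  have left: "u (- (- a + 1)) \<le> u (- (- a))"
  proof (rule bounded_convex_right[of "\<lambda>y. u (- y)" C "- a"])
    fix y assume "- a < y"
    moreover have "- (y + 1) = - y - 1" "- (y - 1) = - y + 1" by simp_all
    ultimately show "0 \<le> u (- (y + 1)) - 2 * u (- y) + u (- (y - 1))"
      using convex[of "- y"] by (simp only:) linarith
  qed (rule bounded)
  have "(\<Sum>y=a..b. u (y + 1) - 2 * u y + u (y - 1)) = u (b + 1) - u b - (u a - u (a - 1))"
    using \<open>a \<le> b\<close>
  proof (induction b rule: int_ge_induct)
    case (step i)
    have "{a..i + 1} = insert (i + 1) {a..i}" using step by auto
    then show ?case using step by simp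
  qed simp
  with left right show ?thesis by simp
qed

lemma ex_antidifference: "\<exists>g. \<forall>y. g y - g (y - 1) = f y" for f :: "int \<Rightarrow> real"
proof (intro exI allI)
  fix y :: int
  define g where "g y = (\<Sum>i\<in>{0..y}. f i) - (\<Sum>i\<in>{y<..<0}. f i)" for y
  have "{0..y} = insert y {0..y - 1}" "{y - 1<..<0} = {}" if "y \<ge> 0" using that by auto
  moreover have "{y - 1<..<0} = insert y {y<..<0}" if "y < 0" using that by auto
  ultimately show "g y - g (y - 1) = f y"
    by (cases "y \<ge> 0") (simp_all add: g_def)
qed

text \<open>A bounded second difference makes the first difference Lipschitz, whence a discrete
  Taylor expansion with quadratic remainder: the form that a step of mean zero and finite variance
  can integrate.\<close>

lemma ex_second_antidifference:
  fixes f :: "int \<Rightarrow> real"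
  assumes bounded: "\<And>y. \<bar>f y\<bar> \<le> B"
  obtains F :: "int \<Rightarrow> real" where "\<And>y. F (y + 1) - 2 * F y + F (y - 1) = f y"
    and "\<And>c z. \<bar>F (c + z) - F c - real_of_int z * (F (c + 1) - F c)\<bar> \<le> B * (real_of_int z)\<^sup>2"
proof -
  obtain g where g: "\<And>y. g y - g (y - 1) = f y" using ex_antidifference by metis
  obtain F where F: "\<And>y. F y - F (y - 1) = g (y - 1)"
    using ex_antidifference[of "\<lambda>y. g (y - 1)"] by metis
  have F1: "F (y + 1) = F y + g y" for y using F[of "y + 1"] by simp
  have B: "B \<ge> 0" using bounded[of 0] by simp
  have lip: "\<bar>g (c + z) - g c\<bar> \<le> B * \<bar>real_of_int z\<bar>" for c z
  proof (induction z rule: int_induct[where k = 0])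
    case (step1 i)
    then show ?case using g[of "c + i + 1"] bounded[of "c + i + 1"] by (simp add: algebra_simps)
  next
    case (step2 i)
    then show ?case using g[of "c + i"] bounded[of "c + i"] by (simp add: algebra_simps)
  qed simp
  have taylor: "\<bar>F (c + z) - F c - real_of_int z * g c\<bar> \<le> B * (real_of_int z)\<^sup>2" for c z
  proof (induction z rule: int_induct[where k = 0])
    case (step1 i)
    have "F (c + (i + 1)) - F c - real_of_int (i + 1) * g c
      = (F (c + i) - F c - real_of_int i * g c) + (g (c + i) - g c)"
      using F1[of "c + i"] by (simp add: algebra_simps)
    also have "\<bar>\<dots>\<bar> \<le> B * (real_of_int i)\<^sup>2 + B * \<bar>real_of_int i\<bar>"
      using step1 lip[of c i] by linarith
    also have "\<dots> \<le> B * (real_of_int (i + 1))\<^sup>2"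
      using step1 B by (simp add: power2_eq_square algebra_simps)
    finally show ?case .
  next
    case (step2 i)
    have "F (c + (i - 1)) - F c - real_of_int (i - 1) * g c
      = (F (c + i) - F c - real_of_int i * g c) - (g (c + (i - 1)) - g c)"
      using F1[of "c + (i - 1)"] by (simp add: algebra_simps)
    also have "\<bar>\<dots>\<bar> \<le> B * (real_of_int i)\<^sup>2 + B * \<bar>real_of_int (i - 1)\<bar>"
      using step2 lip[of c "i - 1"] by linarith
    also have "\<dots> = B * ((real_of_int i)\<^sup>2 - real_of_int i + 1)"
      using step2 by (simp add: algebra_simps)
    also have "\<dots> \<le> B * (real_of_int (i - 1))\<^sup>2"
      using step2 B by (intro mult_left_mono) (simp_all add: power2_eq_square algebra_simps)
    finally show ?case .
  qed simp
  show thesis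
  proof (rule that)
    show "F (y + 1) - 2 * F y + F (y - 1) = f y" for y
      using F[of y] F1[of y] g[of y] by simp
    show "\<bar>F (c + z) - F c - real_of_int z * (F (c + 1) - F c)\<bar> \<le> B * (real_of_int z)\<^sup>2" for c z
      using taylor[of c z] F1[of c] by simp
  qed
qed

section \<open>Generator and energy density\<close>

definition generator :: "int pmf \<Rightarrow> (int \<Rightarrow> real) \<Rightarrow> int \<Rightarrow> real" where
  "generator p f y = measure_pmf.expectation p (\<lambda>k. f (y + k)) - f y"

definition carre_du_champ :: "int pmf \<Rightarrow> (int \<Rightarrow> real) \<Rightarrow> int \<Rightarrow> real" where
  "carre_du_champ p f y = measure_pmf.expectation p (\<lambda>k. (f (y + k) - f y)\<^sup>2) / 2"

lemma integrable_pmf_bounded: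
  fixes f :: "'a \<Rightarrow> real"
  assumes "\<And>k. \<bar>f k\<bar> \<le> B"
  shows "integrable (measure_pmf p) f"
  using assms by (intro measure_pmf.integrable_const_bound[where B = B]) auto

lemma carre_du_champ_nonneg: "carre_du_champ p f y \<ge> 0"
  by (simp add: carre_du_champ_def)

lemma integrable_square_increment:
  fixes f :: "int \<Rightarrow> real"
  assumes "\<And>y. \<bar>f y\<bar> \<le> B"
  shows "integrable (measure_pmf p) (\<lambda>k. (f (y + k) - f y)\<^sup>2)"
proof (rule integrable_pmf_bounded)
  fix k
  have "\<bar>f (y + k) - f y\<bar> \<le> \<bar>2 * B\<bar>" using assms[of y] assms[of "y + k"] by linarith
  then show "\<bar>(f (y + k) - f y)\<^sup>2\<bar> \<le> (2 * B)\<^sup>2"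
    using abs_le_square_iff[of "f (y + k) - f y" "2 * B"] by simp
qed

text \<open>Expanding the square shows the energy density as the defect of the Leibniz rule. Where
  \<open>f\<close> is harmonic its square is subharmonic, and totals of the generator of the square
  control energy.\<close>

lemma generator_square:
  assumes "\<And>y. \<bar>f y\<bar> \<le> B"
  shows "generator p (\<lambda>y. (f y)\<^sup>2) y = 2 * f y * generator p f y + 2 * carre_du_champ p f y"
proof -
  have B: "B \<ge> 0" using assms[of 0] by simp
  have [simp]: "integrable (measure_pmf p) (\<lambda>k. f (y + k))"
    using assms by (rule integrable_pmf_bounded)
  have [simp]: "integrable (measure_pmf p) (\<lambda>k. (f (y + k))\<^sup>2)"
    using assms by (intro integrable_pmf_bounded[where B = "B\<^sup>2"])
      (simp add: abs_le_square_iff[symmetric] B)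
  have "measure_pmf.expectation p (\<lambda>k. (f (y + k) - f y)\<^sup>2)
    = measure_pmf.expectation p (\<lambda>k. (f (y + k))\<^sup>2 - (2 * f y) * f (y + k) + (f y)\<^sup>2)"
    by (simp add: power2_diff mult.commute mult.left_commute algebra_simps)
  also have "\<dots> = measure_pmf.expectation p (\<lambda>k. (f (y + k))\<^sup>2)
      - (2 * f y) * measure_pmf.expectation p (\<lambda>k. f (y + k)) + (f y)\<^sup>2"
    by (simp add: measure_pmf.prob_space)
  finally show ?thesis
    by (simp add: generator_def carre_du_champ_def power2_eq_square algebra_simps)
qed

lemma generator_diff:
  assumes "\<And>y. \<bar>f y\<bar> \<le> B" "\<And>y. \<bar>g y\<bar> \<le> C"
  shows "generator p (\<lambda>y. f y - g y) y = generator p f y - generator p g y"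
  using assms integrable_pmf_bounded[of "\<lambda>k. f (y + k)" B p] integrable_pmf_bounded[of "\<lambda>k. g (y + k)" C p]
  by (simp add: generator_def)

lemma generator_diff_const:
  assumes "\<And>y. \<bar>f y\<bar> \<le> B"
  shows "generator p (\<lambda>y. f y - c) y = generator p f y"
  using generator_diff[of f B "\<lambda>_. c" "\<bar>c\<bar>" p y] assms
  by (simp add: generator_def measure_pmf.prob_space)

lemma generator_uminus: "generator p (\<lambda>y. - f y) y = - generator p f y"
  by (simp add: generator_def)

text \<open>Irreducibility is given by finite lists of possible steps, so that functions can be
  compared along deterministic paths. Finite variance carries the potential theory; the third moment
  enters only in the mean of the diameter increments.\<close>

locale centered_walk =
  fixes p :: "int pmf"
  assumes irreducible: "\<exists>xs. set xs \<subseteq> set_pmf p \<and> sum_list xs = y"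
    and second_moment: "integrable (measure_pmf p) (\<lambda>k. (real_of_int k)\<^sup>2)"
    and centered: "measure_pmf.expectation p real_of_int = 0"
begin

lemma first_moment: "integrable (measure_pmf p) real_of_int"
proof (rule Bochner_Integration.integrable_bound[OF second_moment])
  show "AE k in measure_pmf p. norm (real_of_int k) \<le> norm ((real_of_int k)\<^sup>2)"
  proof (intro AE_I2)
    fix k :: int
    have "\<bar>k\<bar> \<le> k\<^sup>2"
      using self_le_power[of "\<bar>k\<bar>" 2] by (cases "k = 0") auto
    then show "norm (real_of_int k) \<le> norm ((real_of_int k)\<^sup>2)"
      by (metis norm_of_int of_int_abs of_int_le_iff of_int_power abs_power2 real_norm_def)
  qed
qed simp

text \<open>The generator commutes with translations, so the convexity inequality passes from
  \<open>u\<close>, the generator of \<open>F\<close>, to \<open>f\<close>. One-point windows give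
  pointwise statements, long windows give total energy.\<close>

lemma generator_sum_nonpos:
  assumes bounded: "\<And>y. \<bar>f y\<bar> \<le> B" and ab: "a \<le> b"
    and subharmonic: "\<And>y. y < a \<or> b < y \<Longrightarrow> 0 \<le> generator p f y"
  shows "(\<Sum>y=a..b. generator p f y) \<le> 0"
proof -
  obtain F :: "int \<Rightarrow> real" where F: "\<And>y. F (y + 1) - 2 * F y + F (y - 1) = f y"
    and taylor: "\<And>c z. \<bar>F (c + z) - F c - real_of_int z * (F (c + 1) - F c)\<bar> \<le> B * (real_of_int z)\<^sup>2"
    using ex_second_antidifference[of f B] bounded by blast
  define rem where "rem c k = F (c + k) - F c - real_of_int k * (F (c + 1) - F c)" for c k
  have rem_le: "\<bar>rem c k\<bar> \<le> B * (real_of_int k)\<^sup>2" for c k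
    unfolding rem_def by (rule taylor)
  have rem: "integrable (measure_pmf p) (rem c)" for c
    by (rule Bochner_Integration.integrable_bound[OF integrable_mult_right[OF second_moment, of B]])
      (use rem_le in \<open>auto intro: order_trans[OF _ abs_ge_self]\<close>)
  define slope where "slope c = F (c + 1) - F c" for c
  have F_eq: "F (c + k) = rem c k + F c + real_of_int k * slope c" for c k
    by (simp add: rem_def slope_def)
  have int_F: "integrable (measure_pmf p) (\<lambda>k. F (c + k))" for c
    unfolding F_eq by (intro Bochner_Integration.integrable_add rem integrable_mult_left first_moment) simp
  \<comment> \<open>The mean-zero step kills the linear Taylor term, so even an unbounded
    \<open>F\<close> leaves only a remainder of bounded expectation.\<close>
  have gen_F: "generator p F c = measure_pmf.expectation p (rem c)" for c
    unfolding generator_def F_eq using rem first_moment centered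
    by (simp add: measure_pmf.prob_space)
  define u where "u = generator p F"
  have u_bounded: "\<bar>u c\<bar> \<le> B * measure_pmf.expectation p (\<lambda>k. (real_of_int k)\<^sup>2)" for c
  proof -
    have "\<bar>u c\<bar> \<le> measure_pmf.expectation p (\<lambda>k. \<bar>rem c k\<bar>)"
      unfolding u_def gen_F by (rule integral_abs_bound)
    also have "\<dots> \<le> measure_pmf.expectation p (\<lambda>k. B * (real_of_int k)\<^sup>2)"
      using rem_le rem second_moment by (intro integral_mono) auto
    finally show ?thesis by simp
  qed
  have u_diff: "u (y + 1) - 2 * u y + u (y - 1) = generator p f y" for y
  proof -
    have "f (y + k) = F (y + 1 + k) - 2 * F (y + k) + F (y - 1 + k)" for k
      using F[of "y + k"] by (simp add: add.commute add.left_commute add_diff_eq diff_add_eq)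
    then have "measure_pmf.expectation p (\<lambda>k. f (y + k)) = measure_pmf.expectation p
       (\<lambda>k. F (y + 1 + k) - 2 * F (y + k) + F (y - 1 + k))"
      by simp
    also have "\<dots> = measure_pmf.expectation p (\<lambda>k. F (y + 1 + k))
        - 2 * measure_pmf.expectation p (\<lambda>k. F (y + k)) + measure_pmf.expectation p (\<lambda>k. F (y - 1 + k))"
      using int_F by simp
    finally show ?thesis using F[of y] by (simp add: u_def generator_def)
  qed
  show ?thesis
    using bounded_second_difference_sum[of u _ a b, OF u_bounded ab] subharmonic
    by (simp add: u_diff)
qed

text \<open>A one-point window forces \<open>f\<close> to be harmonic. The same window for the
  square of \<open>f\<close> kills its energy density, so \<open>f\<close> does not change along
  possible steps, and these connect all sites.\<close>

lemma bounded_subharmonic_constant: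
  assumes bounded: "\<And>y. \<bar>f y\<bar> \<le> B" and subharmonic: "\<And>y. 0 \<le> generator p f y"
  shows "f x = f y"
proof -
  have harmonic: "generator p f y = 0" for y
    using generator_sum_nonpos[of f B y y] bounded subharmonic by (simp add: antisym)
  have B: "B \<ge> 0" using bounded[of 0] by simp
  have "carre_du_champ p f y = 0" for y
    using generator_sum_nonpos[of "\<lambda>y. (f y)\<^sup>2" "B\<^sup>2" y y] bounded B carre_du_champ_nonneg[of p f]
    by (simp add: generator_square[OF bounded] harmonic abs_le_square_iff[symmetric] antisym)
  then have "AE k in measure_pmf p. (f (y + k) - f y)\<^sup>2 = 0" for y
    using integral_nonneg_eq_0_iff_AE[OF integrable_square_increment[of f B p y, OF bounded]]
    by (auto simp: carre_du_champ_def)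
  then have step: "f (y + k) = f y" if "k \<in> set_pmf p" for y k
    using that by (auto simp: AE_measure_pmf_iff)
  have "f (x + sum_list xs) = f x" if "set xs \<subseteq> set_pmf p" for xs
    using that
  proof (induction xs rule: rev_induct)
    case (snoc k xs)
    then show ?case using step[of k "x + sum_list xs"] by (simp add: add.assoc)
  qed simp
  then show ?thesis using irreducible[of "y - x"] by fastforce
qed

end

section \<open>Hitting probabilities\<close>

text \<open>Removes the extended naturals and leaves a countable combination of coordinate events.
  \<open>B\<close> is avoided up to and including time \<open>n\<close>, so ties do not
  count.\<close>

lemma hit_time_less_iff:
  "hit_time A r < hit_time B r \<longleftrightarrow> (\<exists>n>0. r n \<in> A \<and> (\<forall>m\<le>n. 0 < m \<longrightarrow> r m \<notin> B))"
proof -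
  have "enat n < hit_time B r \<longleftrightarrow> (\<forall>m\<le>n. 0 < m \<longrightarrow> r m \<notin> B)" for n
  proof -
    have "enat n < hit_time B r \<longleftrightarrow> eSuc (enat n) \<le> hit_time B r"
      by (simp add: ileI1 iless_Suc_eq ord_less_eq_trans Suc_ile_eq eSuc_enat)
    also have "\<dots> \<longleftrightarrow> (\<forall>m. 0 < m \<and> r m \<in> B \<longrightarrow> Suc n \<le> m)"
      by (simp add: hit_time_def le_Inf_iff eSuc_enat)
    also have "\<dots> \<longleftrightarrow> (\<forall>m\<le>n. 0 < m \<longrightarrow> r m \<notin> B)"
      by (metis not_less_eq_eq)
    finally show ?thesis .
  qed
  then show ?thesis
    unfolding hit_time_def[of A] by (auto simp: Inf_less_iff)
qed

definition walk_path :: "int \<Rightarrow> (nat \<Rightarrow> int) \<Rightarrow> nat \<Rightarrow> int" where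
  "walk_path x \<omega> n = x + (\<Sum>i<n. \<omega> i)"

lemma walk_path_case_nat: "walk_path x (case_nat k \<omega>) (Suc n) = walk_path (x + k) \<omega> n"
  by (simp add: walk_path_def sum.lessThan_Suc_shift del: sum.lessThan_Suc)

lemma walk_path_0 [simp]: "walk_path x \<omega> 0 = x"
  by (simp add: walk_path_def)

lemma measurable_walk_path [measurable]:
  "walk_path x \<in> (\<Pi>\<^sub>M i\<in>(UNIV :: nat set). measure_pmf p) \<rightarrow>\<^sub>M (\<Pi>\<^sub>M i\<in>(UNIV :: nat set). count_space UNIV)"
proof -
  have sets: "sets (\<Pi>\<^sub>M i\<in>(UNIV :: nat set). measure_pmf p) = sets (\<Pi>\<^sub>M i\<in>(UNIV :: nat set). count_space UNIV)"
    by (intro sets_PiM_cong) auto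
  have "(\<lambda>\<omega>. walk_path x \<omega> n) \<in> (\<Pi>\<^sub>M i\<in>(UNIV :: nat set). count_space UNIV) \<rightarrow>\<^sub>M count_space UNIV" for n
  proof (induction n)
    case (Suc n)
    have "(\<lambda>\<omega>. i + \<omega> n) \<in> (\<Pi>\<^sub>M i\<in>(UNIV :: nat set). count_space UNIV) \<rightarrow>\<^sub>M count_space UNIV" for i :: int
      by (rule measurable_compose[OF measurable_component_singleton]) auto
    from measurable_compose_countable[of "\<lambda>i \<omega>. i + \<omega> n", OF this Suc] show ?case
      by (simp add: walk_path_def add.assoc)
  qed simp
  then show ?thesis
    by (subst measurable_cong_sets[OF sets refl], intro measurable_PiM_single') (auto simp: space_PiM)
qed

lemma walk_law_eq: "walk_law p x = distr (\<Pi>\<^sub>M i\<in>(UNIV :: nat set). measure_pmf p)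
     (\<Pi>\<^sub>M i\<in>(UNIV :: nat set). count_space UNIV) (walk_path x)"
  by (simp add: walk_law_def walk_path_def[abs_def])

lemma pred_walk_sets:
  assumes "Measurable.pred (\<Pi>\<^sub>M i\<in>(UNIV :: nat set). count_space UNIV) P"
  shows "Collect P \<in> sets (\<Pi>\<^sub>M i\<in>(UNIV :: nat set). count_space (UNIV :: int set))"
  using assms by (simp add: pred_def space_PiM)

lemma walk_law_prob:
  assumes "Measurable.pred (\<Pi>\<^sub>M i\<in>(UNIV :: nat set). count_space UNIV) P"
  shows "\<P>(r in walk_law p x. P r) = measure (\<Pi>\<^sub>M i\<in>(UNIV :: nat set). measure_pmf p) {\<omega>. P (walk_path x \<omega>)}"
  unfolding walk_law_eq using pred_walk_sets[OF assms]
  by (subst measure_distr) (auto simp: space_PiM vimage_def)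

lemma measurable_hit_event [measurable]:
  "Measurable.pred (\<Pi>\<^sub>M i\<in>(UNIV :: nat set). count_space UNIV) (\<lambda>r. hit_time A r < hit_time B r)"
  unfolding hit_time_less_iff by measurable

text \<open>Unlike \<open>hit_before\<close>, this counts a hit at time \<open>0\<close>.\<close>

definition hit_ext :: "int pmf \<Rightarrow> int set \<Rightarrow> int set \<Rightarrow> int \<Rightarrow> real" where
  "hit_ext p A B z = (if z \<in> B then 0 else if z \<in> A then 1 else hit_before p z A B)"

text \<open>Time 1 of the walk is time 0 of the walk restarted after its first step. The new
  starting point thus counts as a hit, which is why the first-step equation involves
  \<open>hit_ext\<close>.\<close>

lemma walk_hit_event_case_nat:
  "hit_time A (walk_path x (case_nat k \<omega>)) < hit_time B (walk_path x (case_nat k \<omega>)) \<longleftrightarrow>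
   x + k \<notin> B \<and> (x + k \<in> A \<or> hit_time A (walk_path (x + k) \<omega>) < hit_time B (walk_path (x + k) \<omega>))"
  (is "?L \<longleftrightarrow> ?R")
proof -
  define r where "r = walk_path (x + k) \<omega>"
  have r0: "r 0 = x + k" by (simp add: r_def)
  have ex_Suc: "(\<exists>n>0. P n) \<longleftrightarrow> (\<exists>n. P (Suc n))" for P :: "nat \<Rightarrow> bool"
    by (metis gr0_conv_Suc zero_less_Suc)
  have all_Suc: "(\<forall>m\<le>Suc n. 0 < m \<longrightarrow> Q m) \<longleftrightarrow> (\<forall>m\<le>n. Q (Suc m))" for n and Q :: "nat \<Rightarrow> bool"
    by (metis Suc_le_mono gr0_conv_Suc zero_less_Suc)
  have "?L \<longleftrightarrow> (\<exists>n. r n \<in> A \<and> (\<forall>m\<le>n. r m \<notin> B))"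
    by (simp only: hit_time_less_iff ex_Suc all_Suc walk_path_case_nat r_def)
  also have "\<dots> \<longleftrightarrow> r 0 \<notin> B \<and> (r 0 \<in> A \<or> (\<exists>n>0. r n \<in> A \<and> (\<forall>m\<le>n. 0 < m \<longrightarrow> r m \<notin> B)))"
    (is "?M \<longleftrightarrow> ?N")
  proof
    assume ?M
    then obtain n where n: "r n \<in> A" "\<forall>m\<le>n. r m \<notin> B" by blast
    then show ?N by (cases "n = 0") auto
  next
    assume N: ?N
    show ?M
    proof (cases "r 0 \<in> A")
      case False
      with N obtain n where n: "r n \<in> A" "\<forall>m\<le>n. 0 < m \<longrightarrow> r m \<notin> B" by blast
      with N have "\<forall>m\<le>n. r m \<notin> B" by (metis gr0I)
      with n show ?M by blast
    qed (use N in \<open>auto intro!: exI[of _ 0]\<close>)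
  qed
  finally have "?L \<longleftrightarrow> r 0 \<notin> B \<and> (r 0 \<in> A \<or> hit_time A r < hit_time B r)"
    by (simp only: hit_time_less_iff)
  then show ?thesis by (simp only: r0) (simp only: r_def)
qed

lemma hit_before_eq_measure:
  "hit_before p y A B = measure (\<Pi>\<^sub>M i\<in>(UNIV :: nat set). measure_pmf p)
     {\<omega>. hit_time A (walk_path y \<omega>) < hit_time B (walk_path y \<omega>)}"
  unfolding hit_before_def by (rule walk_law_prob) measurable

text \<open>Markov property at time 1: prepending an independent step preserves the product measure
  (\<open>PiM_iter\<close>), and integrating the slices of the event conditions on that
  step.\<close>

lemma hit_before_step:
  "hit_before p y A B = measure_pmf.expectation p (\<lambda>k. hit_ext p A B (y + k))"
proof -
  interpret sequence_space "measure_pmf p" by standard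
  define X where "X = (\<lambda>y. {\<omega>. hit_time A (walk_path y \<omega>) < hit_time B (walk_path y \<omega>)})"
  have [simp]: "space S = UNIV" by (auto simp: space_PiM)
  have X [measurable]: "X y \<in> sets S" for y
  proof -
    have "{\<omega> \<in> space S. hit_time A (walk_path y \<omega>) < hit_time B (walk_path y \<omega>)} \<in> sets S"
      by measurable
    then show ?thesis by (simp add: X_def)
  qed
  have cond_law: "measure S (case_nat k -` X y) = hit_ext p A B (y + k)" for k
  proof -
    have "case_nat k -` X y = (if y + k \<in> B then {} else if y + k \<in> A then UNIV else X (y + k))"
      by (auto simp: X_def walk_hit_event_case_nat)
    then show ?thesis
      using P.prob_space by (simp add: hit_ext_def hit_before_eq_measure X_def)
  qed
  have cn [measurable]: "(\<lambda>(s, \<omega>). case_nat s \<omega>) \<in> measure_pmf p \<Otimes>\<^sub>M S \<rightarrow>\<^sub>M S"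
    by measurable
  have "emeasure S (X y) = emeasure (distr (measure_pmf p \<Otimes>\<^sub>M S) S (\<lambda>(s, \<omega>). case_nat s \<omega>)) (X y)"
    by (simp add: PiM_iter)
  also have "\<dots> = emeasure (measure_pmf p \<Otimes>\<^sub>M S) ((\<lambda>(s, \<omega>). case_nat s \<omega>) -` X y)"
    using measurable_sets[OF cn X[of y]]
    by (subst emeasure_distr) (auto simp: space_pair_measure)
  also have "\<dots> = (\<integral>\<^sup>+ k. emeasure S (Pair k -` ((\<lambda>(s, \<omega>). case_nat s \<omega>) -` X y)) \<partial>measure_pmf p)"
    using measurable_sets[OF cn X[of y]]
    by (intro emeasure_pair_measure_alt) (auto simp: space_pair_measure)
  also have "\<dots> = (\<integral>\<^sup>+ k. ennreal (hit_ext p A B (y + k)) \<partial>measure_pmf p)"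
    by (intro nn_integral_cong) (simp add: emeasure_eq_measure cond_law[symmetric] vimage_def)
  also have "\<dots> = ennreal (measure_pmf.expectation p (\<lambda>k. hit_ext p A B (y + k)))"
    by (intro nn_integral_eq_integral integrable_pmf_bounded[where B = 1])
       (auto simp: cond_law[symmetric])
  finally have "ennreal (measure S (X y)) = ennreal (measure_pmf.expectation p (\<lambda>k. hit_ext p A B (y + k)))"
    by (simp only: emeasure_eq_measure)
  moreover have "0 \<le> measure_pmf.expectation p (\<lambda>k. hit_ext p A B (y + k))"
    by (intro integral_nonneg_AE) (simp add: cond_law[symmetric])
  ultimately have "measure S (X y) = measure_pmf.expectation p (\<lambda>k. hit_ext p A B (y + k))"
    by (simp add: ennreal_inj)
  then show ?thesis by (simp only: hit_before_eq_measure X_def)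
qed

lemma hit_before_nonneg: "0 \<le> hit_before p y A B"
  by (simp add: hit_before_def)

lemma hit_before_le_1: "hit_before p y A B \<le> 1"
proof -
  interpret sequence_space "measure_pmf p" by standard
  show ?thesis unfolding hit_before_eq_measure by (rule prob_le_1)
qed

lemma hit_ext_nonneg: "0 \<le> hit_ext p A B y"
  by (simp add: hit_ext_def hit_before_nonneg)

lemma hit_ext_le_1: "hit_ext p A B y \<le> 1"
  by (simp add: hit_ext_def hit_before_le_1)

lemma abs_hit_ext_le_1: "\<bar>hit_ext p A B y\<bar> \<le> 1"
  using hit_ext_nonneg[of p A B y] hit_ext_le_1[of p A B y] by simp

lemma generator_hit_ext: "generator p (hit_ext p A B) y = hit_before p y A B - hit_ext p A B y"
  by (simp add: generator_def hit_before_step[symmetric])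

lemma hit_before_add_le_1: "hit_before p y A B + hit_before p y B A \<le> 1"
proof -
  interpret sequence_space "measure_pmf p" by standard
  define X where "X = (\<lambda>A B. {\<omega>. hit_time A (walk_path y \<omega>) < hit_time B (walk_path y \<omega>)})"
  have "{\<omega> \<in> space S. hit_time A (walk_path y \<omega>) < hit_time B (walk_path y \<omega>)} \<in> sets S" for A B
    by measurable
  then have X: "X A B \<in> sets S" for A B by (simp add: X_def space_PiM)
  have "measure S (X A B) + measure S (X B A) = measure S (X A B \<union> X B A)"
    using X by (intro finite_measure_Union[symmetric]) (auto simp: X_def)
  also have "\<dots> \<le> 1" by (rule prob_le_1)
  finally show ?thesis by (simp add: hit_before_eq_measure X_def)
qed

text \<open>An event of positive probability contains a trajectory all of whose steps are possible;
  its first \<open>n\<close> steps form the list.\<close>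

lemma aperiodic_walk_irreducible:
  assumes "aperiodic_walk p"
  shows "\<exists>xs. set xs \<subseteq> set_pmf p \<and> sum_list xs = y"
proof -
  interpret sequence_space "measure_pmf p" by standard
  obtain n where n: "\<P>(r in walk_law p 0. r n = y) \<noteq> 0"
    using assms by (auto simp: aperiodic_walk_def)
  have "\<P>(r in walk_law p 0. r n = y) = measure S {\<omega> \<in> space S. walk_path 0 \<omega> n = y}"
    by (subst walk_law_prob) (auto simp: space_PiM)
  with n have "\<not> (AE \<omega> in S. walk_path 0 \<omega> n \<noteq> y)"
    by (subst AE_iff_measurable) (auto simp: emeasure_eq_measure)
  moreover have "AE \<omega> in S. \<forall>i. \<omega> i \<in> set_pmf p"
    unfolding AE_all_countable
  proof
    fix i
    show "AE \<omega> in S. \<omega> i \<in> set_pmf p"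
      by (rule AE_PiM_component) (auto simp: AE_measure_pmf intro: measure_pmf.prob_space_axioms)
  qed
  ultimately obtain \<omega> where \<omega>: "\<forall>i. \<omega> i \<in> set_pmf p" "walk_path 0 \<omega> n = y"
    by (metis (mono_tags, lifting) AE_mp eventually_mono)
  have "sum_list (map \<omega> [0..<n]) = y"
    using \<omega>(2) by (simp add: walk_path_def interv_sum_list_conv_sum_set_nat lessThan_atLeast0)
  with \<omega>(1) show ?thesis by (intro exI[of _ "map \<omega> [0..<n]"]) auto
qed

section \<open>Maximum principle and energy bound\<close>

lemma pmf_mult_le_expectation:
  fixes f :: "'a \<Rightarrow> real"
  assumes "\<And>k. 0 \<le> f k" and "integrable (measure_pmf p) f"
  shows "pmf p k * f k \<le> measure_pmf.expectation p f"
proof -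
  have "pmf p k * f k = measure_pmf.expectation p (\<lambda>j. f k * indicator {k} j)"
    by (simp add: measure_pmf_single)
  also have "\<dots> \<le> measure_pmf.expectation p f"
  proof (rule integral_mono)
    show "integrable (measure_pmf p) (\<lambda>j. f k * indicator {k} j)"
      using assms(1) by (intro integrable_pmf_bounded[where B = "f k"]) (auto simp: indicator_def)
    show "f k * indicator {k} j \<le> f j" for j
      using assms(1) by (auto simp: indicator_def)
  qed (rule assms(2))
  finally show ?thesis .
qed

context centered_walk
begin

text \<open>\<open>D\<close> may be infinite, so no maximum need be attained. The positive part of
  \<open>f\<close> is bounded and subharmonic everywhere, hence constant by the Liouville property,
  and it vanishes at \<open>z\<close>.\<close>

lemma maximum_principle:
  assumes bounded: "\<And>y. \<bar>f y\<bar> \<le> B"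
    and boundary: "\<And>y. y \<notin> D \<Longrightarrow> f y \<le> 0" and "z \<notin> D"
    and subharmonic: "\<And>y. y \<in> D \<Longrightarrow> 0 \<le> generator p f y"
  shows "f y \<le> 0"
proof -
  define g where "g y = max (f y) 0" for y
  have g_bounded: "\<bar>g y\<bar> \<le> B" for y using bounded[of y] by (auto simp: g_def)
  have "0 \<le> generator p g y" for y
  proof (cases "y \<in> D \<and> f y > 0")
    case True
    have "measure_pmf.expectation p (\<lambda>k. f (y + k)) \<le> measure_pmf.expectation p (\<lambda>k. g (y + k))"
      using bounded g_bounded
      by (intro integral_mono integrable_pmf_bounded[where B = B]) (auto simp: g_def)
    with True subharmonic[of y] show ?thesis by (simp add: generator_def g_def max_def)
  next
    case False
    then have "g y = 0" using boundary[of y] by (auto simp: g_def)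
    then show ?thesis by (simp add: generator_def g_def)
  qed
  then have "g y = g z" by (intro bounded_subharmonic_constant[of g B]) (rule g_bounded)
  with boundary[OF \<open>z \<notin> D\<close>] show ?thesis by (simp add: g_def max_def split: if_splits)
qed

text \<open>Recurrence: off the two sets, \<open>f\<close> is the probability of never meeting them.
  It is bounded, harmonic there and zero on the sets, so the maximum principle makes it
  vanish.\<close>

lemma hit_before_add_eq_1:
  assumes disjoint: "A \<inter> B = {}" and nonempty: "z \<in> A \<union> B"
  shows "hit_before p y A B + hit_before p y B A = 1"
proof -
  define f where "f y = 1 - hit_ext p A B y - hit_ext p B A y" for y
  have f_nonneg: "0 \<le> f y" for y
    using disjoint hit_before_add_le_1[of p y A B] by (auto simp: f_def hit_ext_def)
  have f_le: "\<bar>f y\<bar> \<le> 1" for y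
    using f_nonneg[of y] hit_ext_nonneg[of p A B y] hit_ext_nonneg[of p B A y] by (simp add: f_def)
  have gen: "generator p f y = - generator p (hit_ext p A B) y - generator p (hit_ext p B A) y" for y
  proof -
    have 1: "\<bar>1 - hit_ext p A B y\<bar> \<le> 1" for y
      using hit_ext_nonneg[of p A B y] hit_ext_le_1[of p A B y] by simp
    have "generator p f y = generator p (\<lambda>y. 1 - hit_ext p A B y) y - generator p (hit_ext p B A) y"
      unfolding f_def by (rule generator_diff[OF 1 abs_hit_ext_le_1])
    also have "generator p (\<lambda>y. 1 - hit_ext p A B y) y
        = generator p (\<lambda>_. 1) y - generator p (hit_ext p A B) y"
      by (rule generator_diff[where B = 1, OF _ abs_hit_ext_le_1]) simp
    also have "generator p (\<lambda>_. 1) y = 0" by (simp add: generator_def measure_pmf.prob_space)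
    finally show ?thesis by simp
  qed
  have "f y \<le> 0" for y
  proof (rule maximum_principle[where B = 1 and D = "- (A \<union> B)" and z = z])
    fix y assume "y \<notin> - (A \<union> B)"
    then show "f y \<le> 0" using disjoint by (auto simp: f_def hit_ext_def)
  next
    fix y assume "y \<in> - (A \<union> B)"
    then show "0 \<le> generator p f y" by (simp add: gen generator_hit_ext) (simp add: hit_ext_def)
  qed (use f_le nonempty in auto)
  then have f0: "f y = 0" for y using f_nonneg[of y] by (simp add: antisym)
  \<comment> \<open>With \<open>f\<close> identically zero, its generator vanishes on
    \<open>A\<close> and \<open>B\<close> too, which covers starting points inside these
    sets.\<close>
  have "generator p f y = 0" by (simp add: generator_def f0)
  then show ?thesis using f0[of y] by (simp add: gen generator_hit_ext f_def)
qed

text \<open>By recurrence, failing to return to \<open>x\<close> before \<open>S\<close> means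
  escaping to \<open>S\<close>. Divided by the escape probability, \<open>hit_ext p {x} S\<close> is
  thus the Green function at \<open>x\<close> of the walk killed on \<open>S\<close>.\<close>

lemma generator_hit_ext_point:
  assumes "x \<notin> S" "a \<in> S" "y \<notin> S"
  shows "generator p (hit_ext p {x} S) y = (if y = x then - hit_before p x S {x} else 0)"
  using assms hit_before_add_eq_1[of "{x}" S x x]
  by (auto simp: generator_hit_ext hit_ext_def)

text \<open>The generator of the square of \<open>g\<close> is twice the energy density minus a sink
  at \<open>x\<close> of twice the escape probability: \<open>g\<close> vanishes on \<open>S\<close>
  and is 1 at \<open>x\<close>. Its total over a window containing \<open>x\<close> and
  \<open>F\<close> is nonpositive.\<close>

lemma energy_bound:
  assumes "x \<notin> S" "a \<in> S" "finite F"
  shows "(\<Sum>y\<in>F. carre_du_champ p (hit_ext p {x} S) y) \<le> hit_before p x S {x}"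
proof -
  define g where "g = hit_ext p {x} S"
  define q where "q = hit_before p x S {x}"
  have gx: "g x = 1" and gS: "\<And>y. y \<in> S \<Longrightarrow> g y = 0"
    using assms by (auto simp: g_def hit_ext_def)
  have gen: "generator p (\<lambda>y. (g y)\<^sup>2) y = 2 * carre_du_champ p g y - (if y = x then 2 * q else 0)" for y
    using generator_square[of g 1 p y] abs_hit_ext_le_1 generator_hit_ext_point[of x S a y] assms gx gS[of y]
    by (cases "y \<in> S") (auto simp: g_def q_def)
  have fin: "finite (insert x F)" using assms by simp
  let ?I = "{Min (insert x F)..Max (insert x F)}"
  have sub: "insert x F \<subseteq> ?I" using fin by (meson Max_ge Min_le atLeastAtMost_iff subsetI)
  have "(\<Sum>y\<in>?I. generator p (\<lambda>y. (g y)\<^sup>2) y) \<le> 0"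
  proof (rule generator_sum_nonpos)
    show "\<bar>(g y)\<^sup>2\<bar> \<le> 1" for y
      using abs_hit_ext_le_1[of p "{x}" S y] by (simp add: g_def abs_square_le_1)
    show "Min (insert x F) \<le> Max (insert x F)" using fin by (meson Max_ge Min_le insertI1 order_trans)
    show "0 \<le> generator p (\<lambda>y. (g y)\<^sup>2) y"
      if "y < Min (insert x F) \<or> Max (insert x F) < y" for y
      using that fin carre_du_champ_nonneg[of p g y] by (auto simp: gen)
  qed
  moreover have "(\<Sum>y\<in>?I. (if y = x then 2 * q else 0)) = 2 * q" using sub by simp
  ultimately have "(\<Sum>y\<in>?I. carre_du_champ p g y) \<le> q"
    by (simp add: gen sum_subtractf sum_distrib_left[symmetric])
  moreover have "(\<Sum>y\<in>F. carre_du_champ p g y) \<le> (\<Sum>y\<in>?I. carre_du_champ p g y)"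
    using sub by (intro sum_mono2) (auto simp: carre_du_champ_nonneg)
  ultimately show ?thesis by (simp add: g_def q_def)
qed

text \<open>A fixed sequence of possible steps leads from \<open>y\<close> to \<open>y + 1\<close>, so that the increments of a
  function are controlled by its energy.\<close>

lemma square_increments_bound:
  "\<exists>K>0. \<forall>x S a Y. x \<notin> S \<longrightarrow> a \<in> S \<longrightarrow> finite Y \<longrightarrow>
     (\<Sum>y\<in>Y. (hit_ext p {x} S (y + 1) - hit_ext p {x} S y)\<^sup>2) \<le> K * hit_before p x S {x}"
proof -
  obtain xs where xs: "set xs \<subseteq> set_pmf p" "sum_list xs = 1" using irreducible by blast
  define L where "L = length xs"
  define c where "c = Min (pmf p ` set xs)"
  have "xs \<noteq> []" using xs by auto
  then have L: "L > 0" and c: "c > 0" and c_le: "\<And>i. i < L \<Longrightarrow> c \<le> pmf p (xs ! i)"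
    using xs(1) by (auto simp: L_def c_def pmf_positive)
  define s where "s i = sum_list (take i xs)" for i
  have s_Suc: "s (Suc i) = s i + xs ! i" if "i < L" for i
    using that by (simp add: s_def L_def take_Suc_conv_app_nth)
  have s_0: "s 0 = 0" and s_L: "s L = 1" using xs by (simp_all add: s_def L_def)
  show ?thesis
  \<comment> \<open>Each step of the path has probability at least \<open>c\<close>, whence 2 /
    \<open>c\<close>; Cauchy-Schwarz over the path costs \<open>L\<close>, and the \<open>L\<close>
    translates of \<open>Y\<close> cost another \<open>L\<close>.\<close>
  proof (intro exI[of _ "2 * (real L)\<^sup>2 / c"] conjI allI impI)
    show "0 < 2 * (real L)\<^sup>2 / c" using L c by simp
    fix x a :: int and S Y :: "int set"
    assume xS: "x \<notin> S" "a \<in> S" and Y: "finite Y"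
    define g where "g = hit_ext p {x} S"
    define q where "q = hit_before p x S {x}"
    have edge: "(g (y + k) - g y)\<^sup>2 \<le> 2 / c * carre_du_champ p g y" if "c \<le> pmf p k" for y k
    proof -
      have "c * (g (y + k) - g y)\<^sup>2 \<le> pmf p k * (g (y + k) - g y)\<^sup>2"
        using that by (intro mult_right_mono) auto
      also have "\<dots> \<le> 2 * carre_du_champ p g y"
        using pmf_mult_le_expectation[of "\<lambda>k. (g (y + k) - g y)\<^sup>2" p k]
          integrable_square_increment[of g 1 p y] abs_hit_ext_le_1
        by (simp add: carre_du_champ_def g_def)
      finally show ?thesis using c by (simp add: field_simps)
    qed
    have "(g (y + 1) - g y)\<^sup>2 \<le> real L * (\<Sum>i<L. 2 / c * carre_du_champ p g (y + s i))" for y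
    proof -
      have "g (y + 1) - g y = (\<Sum>i<L. g (y + s (Suc i)) - g (y + s i))"
        by (simp add: sum_lessThan_telescope[of "\<lambda>i. g (y + s i)"] s_0 s_L)
      then have "(g (y + 1) - g y)\<^sup>2 \<le> real L * (\<Sum>i<L. (g (y + s (Suc i)) - g (y + s i))\<^sup>2)"
        using sum_squared_le_sum_of_squares[of "\<lambda>i. g (y + s (Suc i)) - g (y + s i)" "{..<L}"] L
        by (simp add: mult.commute)
      also have "\<dots> \<le> real L * (\<Sum>i<L. 2 / c * carre_du_champ p g (y + s i))"
        using edge[OF c_le, of _ "y + s _"]
        by (intro mult_left_mono sum_mono) (auto simp: s_Suc add.assoc)
      finally show ?thesis .
    qed
    then have "(\<Sum>y\<in>Y. (g (y + 1) - g y)\<^sup>2)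
      \<le> (\<Sum>y\<in>Y. real L * (\<Sum>i<L. 2 / c * carre_du_champ p g (y + s i)))"
      by (rule sum_mono)
    also have "\<dots> = real L * (\<Sum>y\<in>Y. \<Sum>i<L. 2 / c * carre_du_champ p g (y + s i))"
      by (simp add: sum_distrib_left)
    also have "\<dots> = real L * (\<Sum>i<L. 2 / c * (\<Sum>y\<in>Y. carre_du_champ p g (y + s i)))"
      by (subst sum.swap) (simp add: sum_distrib_left)
    also have "\<dots> \<le> real L * (\<Sum>i<L. 2 / c * q)"
    proof (intro mult_left_mono sum_mono)
      fix i
      have "(\<Sum>y\<in>Y. carre_du_champ p g (y + s i)) = (\<Sum>y\<in>(\<lambda>y. y + s i) ` Y. carre_du_champ p g y)"
        by (subst sum.reindex) (auto simp: inj_on_def)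
      also have "\<dots> \<le> q"
        using energy_bound[OF xS, of "(\<lambda>y. y + s i) ` Y"] Y by (simp add: g_def q_def)
      finally show "(\<Sum>y\<in>Y. carre_du_champ p g (y + s i)) \<le> q" .
    qed (use c in auto)
    also have "\<dots> = 2 * (real L)\<^sup>2 / c * q" by (simp add: power2_eq_square)
    finally show "(\<Sum>y\<in>Y. (hit_ext p {x} S (y + 1) - hit_ext p {x} S y)\<^sup>2)
      \<le> 2 * (real L)\<^sup>2 / c * hit_before p x S {x}" by (simp add: g_def q_def)
  qed
qed

text \<open>Between \<open>a\<close> and \<open>x\<close>, \<open>hit_ext\<close> changes by 1 in |x
  - a| unit increments; Cauchy-Schwarz bounds their sum of squares below and the energy bounds it
  above. The constant is uniform in \<open>S\<close>, and \<open>a\<close> may be any of its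
  points.\<close>

lemma escape_lower_bound:
  "\<exists>C>0. \<forall>x S a. x \<notin> S \<longrightarrow> a \<in> S \<longrightarrow>
     0 < hit_before p x S {x} \<and> 1 / hit_before p x S {x} \<le> C * real_of_int \<bar>x - a\<bar>"
proof -
  obtain K where K: "K > 0" and bound: "\<And>x S a Y. x \<notin> S \<Longrightarrow> a \<in> S \<Longrightarrow> finite Y \<Longrightarrow>
     (\<Sum>y\<in>Y. (hit_ext p {x} S (y + 1) - hit_ext p {x} S y)\<^sup>2) \<le> K * hit_before p x S {x}"
    using square_increments_bound by blast
  show ?thesis
  proof (intro exI[of _ K] conjI K allI impI)
    fix x a :: int and S :: "int set"
    assume xS: "x \<notin> S" "a \<in> S"
    define g where "g = hit_ext p {x} S"
    define q where "q = hit_before p x S {x}"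
    define b where "b = min a x"
    define m where "m = nat \<bar>x - a\<bar>"
    have "g (b + int m) - g b = (\<Sum>i<m. g (b + int i + 1) - g (b + int i))"
      using sum_lessThan_telescope[of "\<lambda>i. g (b + int i)" m] by (simp add: add_ac)
    moreover have "(g (b + int m) - g b)\<^sup>2 = 1"
      using xS by (auto simp: g_def b_def m_def hit_ext_def min_def)
    ultimately have "1 \<le> real m * (\<Sum>i<m. (g (b + int i + 1) - g (b + int i))\<^sup>2)"
      using sum_squared_le_sum_of_squares[of "\<lambda>i. g (b + int i + 1) - g (b + int i)" "{..<m}"]
      by (simp add: mult.commute)
    also have "(\<Sum>i<m. (g (b + int i + 1) - g (b + int i))\<^sup>2)
      = (\<Sum>y\<in>(\<lambda>i. b + int i) ` {..<m}. (g (y + 1) - g y)\<^sup>2)"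
      by (subst sum.reindex) (auto simp: inj_on_def)
    also have "real m * \<dots> \<le> real m * (K * q)"
      using bound[OF xS, of "(\<lambda>i. b + int i) ` {..<m}"] by (intro mult_left_mono) (auto simp: g_def q_def)
    finally have 1: "1 \<le> real m * (K * q)" .
    then have "0 < real m * (K * q)" by linarith
    moreover have q0: "0 \<le> q" by (simp add: q_def hit_before_nonneg)
    ultimately have q: "0 < q" using K by (cases "q = 0") auto
    then show "0 < hit_before p x S {x}" by (simp add: q_def)
    show "1 / hit_before p x S {x} \<le> K * real_of_int \<bar>x - a\<bar>"
      using 1 q by (simp add: q_def[symmetric] m_def field_simps)
  qed
qed

end

section \<open>Limits of harmonic functions at infinity\<close>

lemma integrable_pmf_indicator [simp]: "integrable (measure_pmf p) (indicator X :: 'a \<Rightarrow> real)"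
  by (rule integrable_pmf_bounded[where B = 1]) (simp add: indicator_def)

text \<open>Layer-cake summation: a jump k is counted by at most |k| indices, each contributing at
  most |k|^r; index 0 drops out as \<open>r > 0\<close>. Used with r = 1 for overshoots and r = 2
  for the mean of the increments.\<close>

lemma summable_tail_prob:
  fixes p :: "int pmf"
  assumes "r > 0" and moment: "integrable (measure_pmf p) (\<lambda>k. \<bar>real_of_int k\<bar> ^ Suc r)"
  shows "summable (\<lambda>m. real m ^ r * measure_pmf.prob p {k. int m \<le> \<bar>k\<bar>})"
proof (rule summableI_nonneg_bounded)
  fix M
  have "(\<Sum>m<M. real m ^ r * measure_pmf.prob p {k. int m \<le> \<bar>k\<bar>})
    = measure_pmf.expectation p (\<lambda>k. \<Sum>m<M. real m ^ r * indicator {k. int m \<le> \<bar>k\<bar>} k)"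
    by (subst Bochner_Integration.integral_sum) simp_all
  also have "\<dots> \<le> measure_pmf.expectation p (\<lambda>k. \<bar>real_of_int k\<bar> ^ Suc r)"
  proof (rule integral_mono)
    fix k :: int
    have "(\<Sum>m<M. real m ^ r * indicator {k. int m \<le> \<bar>k\<bar>} k)
        = (\<Sum>m\<in>{m. m < M \<and> 0 < m \<and> int m \<le> \<bar>k\<bar>}. real m ^ r)"
      using \<open>r > 0\<close> by (intro sum.mono_neutral_cong_right) (auto simp: indicator_def)
    also have "\<dots> \<le> (\<Sum>m\<in>{1..nat \<bar>k\<bar>}. \<bar>real_of_int k\<bar> ^ r)"
    proof (rule order_trans[OF sum_mono sum_mono2])
      show "real m ^ r \<le> \<bar>real_of_int k\<bar> ^ r" if "m \<in> {m. m < M \<and> 0 < m \<and> int m \<le> \<bar>k\<bar>}" for m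
      proof (rule power_mono)
        have "int m \<le> \<bar>k\<bar>" using that by simp
        then have "real_of_int (int m) \<le> real_of_int \<bar>k\<bar>" by (simp only: of_int_le_iff)
        then show "real m \<le> \<bar>real_of_int k\<bar>" by simp
      qed simp
    qed auto
    also have "\<dots> = \<bar>real_of_int k\<bar> ^ Suc r" by simp
    finally show "(\<Sum>m<M. real m ^ r * indicator {k. int m \<le> \<bar>k\<bar>} k) \<le> \<bar>real_of_int k\<bar> ^ Suc r" .
  next
    show "integrable (measure_pmf p) (\<lambda>k. \<Sum>m<M. real m ^ r * indicator {k. int m \<le> \<bar>k\<bar>} k)"
      by (rule Bochner_Integration.integrable_sum) simp
  qed (rule moment)
  finally show "(\<Sum>m<M. real m ^ r * measure_pmf.prob p {k. int m \<le> \<bar>k\<bar>})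
      \<le> measure_pmf.expectation p (\<lambda>k. \<bar>real_of_int k\<bar> ^ Suc r)" .
qed simp

context centered_walk
begin

text \<open>\<open>V\<close> is a Green potential of the overshoot beyond \<open>- W\<close>. Killing the walk only at \<open>0\<close> and not on
  the whole half-line makes the Green function larger, but \<open>escape_lower_bound\<close> controls it.\<close>

lemma overshoot_barrier:
  assumes "\<delta> > 0"
  shows "\<exists>(W::nat) V. bounded (range V) \<and> (\<forall>y. 0 \<le> V y) \<and> (\<forall>y < - int W. 1 \<le> V y) \<and>
    (\<forall>y>0. generator p V y \<le> 0) \<and> (\<forall>y>0. V y \<le> \<delta>)"
proof -
  obtain C where C: "C > 0" and escape: "\<And>x S a. x \<notin> S \<Longrightarrow> a \<in> S \<Longrightarrow>
      0 < hit_before p x S {x} \<and> 1 / hit_before p x S {x} \<le> C * real_of_int \<bar>x - a\<bar>"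
    using escape_lower_bound by blast
  define T where "T m = measure_pmf.prob p {k. int m \<le> \<bar>k\<bar>}" for m
  have "summable (\<lambda>m. C * (real m ^ 1 * T m))"
    unfolding T_def using second_moment
    by (intro summable_mult summable_tail_prob) (simp_all add: numeral_2_eq_2[symmetric])
  then have sumT: "summable (\<lambda>m. C * (real m * T m))" by simp
  obtain W where W: "norm (\<Sum>n. C * (real (n + Suc W) * T (n + Suc W))) < \<delta>"
    using suminf_exist_split[OF \<open>\<delta> > 0\<close> sumT] by (metis le_SucI order_refl)
  define q where "q n = hit_before p (int n + 1) {0} {int n + 1}" for n
  \<comment> \<open>\<open>G n y\<close> is the expected number of visits to
    \<open>int n + 1\<close> before 0, and \<open>t n\<close> the chance of jumping from there below
    \<open>- W\<close>, so \<open>P\<close> counts such jumps in expectation.\<close>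
  define G where "G n y = hit_ext p {int n + 1} {0} y / q n" for n y
  define t where "t n = measure_pmf.prob p {k. k < - int W - int n - 1}" for n
  have q: "q n > 0" "1 / q n \<le> C * real (Suc n)" for n
    using escape[of "int n + 1" "{0}" 0] by (auto simp: q_def add.commute)
  have G0: "0 \<le> G n y" for n y using q[of n] by (simp add: G_def hit_ext_nonneg)
  have G_le: "G n y \<le> C * real (Suc n)" for n y
  proof -
    have "G n y \<le> 1 / q n" unfolding G_def using q[of n] by (intro divide_right_mono hit_ext_le_1) simp
    then show ?thesis using q[of n] by linarith
  qed
  have t0: "0 \<le> t n" for n by (simp add: t_def)
  have Gt_le: "G n y * t n \<le> C * (real (n + Suc W) * T (n + Suc W))" for n y
  proof -
    have "t n \<le> T (n + Suc W)"
      unfolding t_def T_def by (intro measure_pmf.finite_measure_mono) auto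
    then have "G n y * t n \<le> (C * real (n + Suc W)) * T (n + Suc W)"
      using G_le[of n y] t0[of n] C
      by (intro mult_mono) (auto intro: order_trans mult_left_mono)
    then show ?thesis by (simp add: mult.assoc)
  qed
  have sumT': "summable (\<lambda>n. C * (real (n + Suc W) * T (n + Suc W)))"
    using sumT by (subst (asm) summable_iff_shift[symmetric, of _ "Suc W"])
  have sumG: "summable (\<lambda>n. G n y * t n)" for y
    using Gt_le G0 t0 by (intro summable_comparison_test'[OF sumT', of 0]) simp
  define P where "P y = (\<Sum>n. G n y * t n)" for y
  define V where "V y = (if y < - int W then 1 else 0) + P y" for y
  have P0: "0 \<le> P y" for y unfolding P_def using G0 t0 sumG by (intro suminf_nonneg) auto
  have P_le: "P y \<le> \<delta>" for y
  proof -
    have "P y \<le> (\<Sum>n. C * (real (n + Suc W) * T (n + Suc W)))"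
      unfolding P_def using Gt_le by (intro suminf_le sumG sumT') auto
    then show ?thesis using W by simp
  qed
  have P_abs: "\<bar>P y\<bar> \<le> \<delta>" for y using P0 P_le by simp
  \<comment> \<open>A direct jump from \<open>y\<close> below \<open>- W\<close> adds
    \<open>t m\<close>, and the sink of \<open>G m\<close> at \<open>y\<close> removes exactly this
    amount.\<close>
  have gen_V: "generator p V y = 0" if "y > 0" for y
  proof -
    define m where "m = nat (y - 1)"
    have m: "y = int m + 1" using that by (simp add: m_def)
    have "measure_pmf.expectation p (\<lambda>k. V (y + k))
      = measure_pmf.expectation p (\<lambda>k. indicator {k. k < - int W - int m - 1} k)
        + measure_pmf.expectation p (\<lambda>k. P (y + k))"
      unfolding V_def using P_abs
      by (subst Bochner_Integration.integral_add[symmetric])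
        (auto intro!: integrable_pmf_bounded[where B = 1] integrable_pmf_bounded[where B = \<delta>]
          Bochner_Integration.integral_cong simp: indicator_def m)
    also have "measure_pmf.expectation p (\<lambda>k. indicator {k. k < - int W - int m - 1} k) = t m"
      by (simp add: t_def)
    also have "measure_pmf.expectation p (\<lambda>k. P (y + k))
        = (\<Sum>n. measure_pmf.expectation p (\<lambda>k. G n (y + k) * t n))"
      unfolding P_def
    proof (rule integral_suminf)
      show "integrable (measure_pmf p) (\<lambda>k. G n (y + k) * t n)" for n
        using Gt_le[of n] G0 t0
        by (intro integrable_pmf_bounded[where B = "C * (real (n + Suc W) * T (n + Suc W))"]) auto
      show "AE k in measure_pmf p. summable (\<lambda>n. norm (G n (y + k) * t n))"
        using sumG G0 t0 by (simp add: abs_mult)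
      show "summable (\<lambda>n. measure_pmf.expectation p (\<lambda>k. norm (G n (y + k) * t n)))"
      proof (rule summable_comparison_test'[OF sumT', of 0])
        fix n
        have "measure_pmf.expectation p (\<lambda>k. norm (G n (y + k) * t n))
           \<le> measure_pmf.expectation p (\<lambda>k. C * (real (n + Suc W) * T (n + Suc W)))"
        proof (rule integral_mono)
          show "integrable (measure_pmf p) (\<lambda>k. norm (G n (y + k) * t n))"
            using Gt_le[of n] G0 t0
            by (intro integrable_pmf_bounded[where B = "C * (real (n + Suc W) * T (n + Suc W))"]) simp
          show "norm (G n (y + k) * t n) \<le> C * (real (n + Suc W) * T (n + Suc W))" for k
            using Gt_le[of n] G0 t0 by simp
        qed simp
        then show "norm (measure_pmf.expectation p (\<lambda>k. norm (G n (y + k) * t n)))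
           \<le> C * (real (n + Suc W) * T (n + Suc W))"
          using C by (simp add: measure_pmf.prob_space T_def)
      qed
    qed
    also have "\<dots> = (\<Sum>n. G n y * t n + (if n = m then - t m else 0))"
    proof (rule suminf_cong)
      fix n
      have "measure_pmf.expectation p (\<lambda>k. G n (y + k) * t n)
        = (generator p (hit_ext p {int n + 1} {0}) y / q n + G n y) * t n"
        by (simp add: G_def generator_def diff_divide_distrib)
      also have "generator p (hit_ext p {int n + 1} {0}) y / q n = (if n = m then - 1 else 0)"
        using generator_hit_ext_point[of "int n + 1" "{0}" 0 y] q(1)[of n] by (auto simp: m q_def)
      finally show "measure_pmf.expectation p (\<lambda>k. G n (y + k) * t n) = G n y * t n + (if n = m then - t m else 0)"
        by (simp add: algebra_simps)
    qed
    also have "\<dots> = P y - t m"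
      unfolding P_def using sums_add[OF summable_sums[OF sumG[of y]] sums_single[of m "\<lambda>_. - t m"]]
      by (simp add: sums_iff)
    finally show ?thesis using that by (simp add: generator_def V_def)
  qed
  show ?thesis
  proof (intro exI[of _ W] exI[of _ V] conjI allI impI)
    have "norm (V y) \<le> 1 + \<delta>" for y using P_abs[of y] \<open>\<delta> > 0\<close> by (auto simp: V_def)
    then show "bounded (range V)" by (auto simp: bounded_iff)
    show "V y \<le> \<delta>" if "y > 0" for y using that P_le by (simp add: V_def)
  qed (use P0 gen_V in \<open>auto simp: V_def\<close>)
qed

text \<open>Far out, \<open>g\<close> is nearly constant on a window of width \<open>W\<close>. A
  walk started beyond \<open>Y\<close> enters the region left of it inside this window, up to an
  overshoot that the barrier makes improbable, so \<open>g\<close> oscillates little beyond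
  \<open>Y\<close>.\<close>

lemma harmonic_tendsto_at_top:
  assumes bounded: "\<And>y. \<bar>g y\<bar> \<le> B"
    and harmonic: "\<And>y. K < y \<Longrightarrow> generator p g y = 0"
    and increments: "((\<lambda>y. g (y + 1) - g y) \<longlongrightarrow> 0) at_top"
  shows "\<exists>l. (g \<longlongrightarrow> l) at_top"
proof -
  have B: "B \<ge> 0" using bounded[of 0] by simp
  have oscillation: "\<exists>Y. \<forall>y\<ge>Y. \<bar>g y - g Y\<bar> \<le> \<epsilon>" if "\<epsilon> > 0" for \<epsilon>
  proof -
    \<comment> \<open>The window costs \<open>\<delta>\<close> and the overshoot
      \<open>2 * B * \<delta>\<close>; the denominator absorbs both and stays positive for
      \<open>B = 0\<close>.\<close>
    define \<delta> where "\<delta> = \<epsilon> / (2 * B + 2)"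
    have \<delta>: "\<delta> > 0" using that B by (simp add: \<delta>_def)
    obtain W V where V: "bounded (range V)" "\<And>y. 0 \<le> V y" "\<And>y. y < - int W \<Longrightarrow> 1 \<le> V y"
      "\<And>y. y > 0 \<Longrightarrow> generator p V y \<le> 0" "\<And>y. y > 0 \<Longrightarrow> V y \<le> \<delta>"
      using overshoot_barrier[OF \<delta>] by blast
    obtain C where C: "\<And>y. \<bar>V y\<bar> \<le> C" using V(1) by (auto simp: bounded_iff)
    have "eventually (\<lambda>y. \<bar>g (y + 1) - g y\<bar> < \<delta> / (real W + 1)) at_top"
      using increments \<delta> by (auto simp: tendsto_iff dist_real_def)
    then obtain N where N: "\<And>y. y \<ge> N \<Longrightarrow> \<bar>g (y + 1) - g y\<bar> < \<delta> / (real W + 1)"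
      by (auto simp: eventually_at_top_linorder)
    define Y where "Y = max N K + int W"
    have window: "\<bar>g (Y - int i) - g Y\<bar> \<le> real i * (\<delta> / (real W + 1))" if "i \<le> W" for i
      using that
    proof (induction i)
      case (Suc i)
      have "\<bar>g (Y - int (Suc i) + 1) - g (Y - int (Suc i))\<bar> < \<delta> / (real W + 1)"
        using Suc.prems by (intro N) (simp add: Y_def)
      then show ?case using Suc by (simp add: algebra_simps add_divide_distrib)
    qed simp
    have window': "\<bar>g y - g Y\<bar> \<le> \<delta>" if "Y - int W \<le> y" "y \<le> Y" for y
    proof -
      define i where "i = nat (Y - y)"
      have i: "i \<le> W" "y = Y - int i" using that by (auto simp: i_def)
      have "\<bar>g y - g Y\<bar> \<le> real i * (\<delta> / (real W + 1))" using window[OF i(1)] i(2) by simp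
      also have "\<dots> \<le> (real W + 1) * (\<delta> / (real W + 1))" using i(1) \<delta> by (intro mult_right_mono) auto
      finally show ?thesis by simp
    qed
    have far: "h y \<le> \<delta> + 2 * B * V (y - Y)"
      if h_bounded: "\<And>y. \<bar>h y\<bar> \<le> 2 * B" and h_window: "\<And>y. Y - int W \<le> y \<Longrightarrow> y \<le> Y \<Longrightarrow> h y \<le> \<delta>"
        and h_harmonic: "\<And>y. Y < y \<Longrightarrow> generator p h y = 0" for h y
    proof -
      \<comment> \<open>Three ranges: beyond \<open>Y\<close> the function \<open>U\<close> is
        subharmonic, in the window \<open>h\<close> is at most \<open>\<delta>\<close>, and further
        left the crude bound \<open>2 * B\<close> is beaten by \<open>V\<close> being at least
        1.\<close>
      define U where "U y = h y - (\<delta> + 2 * B * V (y - Y))" for y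
      have VB: "\<bar>\<delta> + 2 * B * V (y - Y)\<bar> \<le> \<delta> + 2 * B * C" for y
        using \<delta> B V(2)[of "y - Y"] C[of "y - Y"] by (simp add: mult_left_mono)
      have gen_U: "generator p U y = generator p h y - 2 * B * generator p V (y - Y)" for y
      proof -
        have "generator p U y = generator p h y - generator p (\<lambda>y. \<delta> + 2 * B * V (y - Y)) y"
          unfolding U_def by (rule generator_diff[OF h_bounded VB])
        also have "generator p (\<lambda>y. \<delta> + 2 * B * V (y - Y)) y = 2 * B * generator p V (y - Y)"
          using integrable_pmf_bounded[of "\<lambda>k. V (y - Y + k)" C p] C
          by (simp add: generator_def measure_pmf.prob_space algebra_simps)
        finally show ?thesis .
      qed
      have "U y \<le> 0"
      proof (rule maximum_principle[where D = "{y. Y < y}" and z = Y])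
        show "\<bar>U y\<bar> \<le> 2 * B + (\<delta> + 2 * B * C)" for y
          unfolding U_def using h_bounded[of y] VB[of y] by linarith
        show "0 \<le> generator p U y" if "y \<in> {y. Y < y}" for y
          using that B V(4)[of "y - Y"] h_harmonic[of y] by (simp add: gen_U mult_nonneg_nonpos)
        show "U y \<le> 0" if "y \<notin> {y. Y < y}" for y
        proof (cases "Y - int W \<le> y")
          case True
          moreover have "0 \<le> 2 * B * V (y - Y)" using B V(2) by simp
          ultimately show ?thesis using that h_window[of y] by (simp add: U_def)
        next
          case False
          then have "2 * B * 1 \<le> 2 * B * V (y - Y)" using B V(3)[of "y - Y"] by (intro mult_left_mono) auto
          then show ?thesis using h_bounded[of y] \<delta> by (simp add: U_def)
        qed
      qed simp
      then show ?thesis by (simp add: U_def)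
    qed
    have bd: "\<bar>g y - g Y\<bar> \<le> 2 * B" for y using bounded[of y] bounded[of Y] by linarith
    have harm: "generator p (\<lambda>y. g y - g Y) y = 0" if "Y < y" for y
      using that harmonic[of y] by (simp add: generator_diff_const[OF bounded] Y_def)
    have harm': "generator p (\<lambda>y. - (g y - g Y)) y = 0" if "Y < y" for y
      using harm[OF that] generator_uminus[of p "\<lambda>y. g y - g Y" y] by simp
    show ?thesis
    proof (intro exI[of _ Y] allI impI)
      fix y assume "Y \<le> y"
      show "\<bar>g y - g Y\<bar> \<le> \<epsilon>"
      proof (cases "y = Y")
        case False
        with \<open>Y \<le> y\<close> have y: "y - Y > 0" by simp
        have "g y - g Y \<le> \<delta> + 2 * B * V (y - Y)"
          using far[of "\<lambda>y. g y - g Y" y, OF bd _ harm] window' abs_le_D1 by blast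
        moreover have "- (g y - g Y) \<le> \<delta> + 2 * B * V (y - Y)"
          using far[of "\<lambda>y. - (g y - g Y)" y, OF _ _ harm'] bd window' by (auto simp: abs_minus_commute abs_le_iff)
        moreover have "2 * B * V (y - Y) \<le> 2 * B * \<delta>" using B V(5)[OF y] by (intro mult_left_mono) auto
        moreover have "\<delta> + 2 * B * \<delta> \<le> \<epsilon>"
        proof -
          have "\<delta> + 2 * B * \<delta> \<le> (2 * B + 2) * \<delta>" using \<delta> by (simp add: algebra_simps)
          also have "\<dots> = \<epsilon>" using B by (simp add: \<delta>_def)
          finally show ?thesis .
        qed
        ultimately show ?thesis by linarith
      qed (use that in simp)
    qed
  qed
  have "Cauchy (\<lambda>n. g (int n))"
  proof (rule metric_CauchyI)
    fix e :: real assume "e > 0"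
    then obtain Y where Y: "\<And>y. y \<ge> Y \<Longrightarrow> \<bar>g y - g Y\<bar> \<le> e / 3" using oscillation[of "e / 3"] by auto
    show "\<exists>M. \<forall>m\<ge>M. \<forall>n\<ge>M. dist (g (int m)) (g (int n)) < e"
    proof (intro exI[of _ "nat Y"] allI impI)
      fix m n assume "nat Y \<le> m" "nat Y \<le> n"
      then have "\<bar>g (int m) - g Y\<bar> \<le> e / 3" "\<bar>g (int n) - g Y\<bar> \<le> e / 3"
        using Y[of "int m"] Y[of "int n"] by linarith+
      then show "dist (g (int m)) (g (int n)) < e"
        using \<open>e > 0\<close> unfolding dist_real_def by linarith
    qed
  qed
  then obtain l where l: "(\<lambda>n. g (int n)) \<longlonglongrightarrow> l" using Cauchy_convergent convergent_def by blast
  have "(g \<longlongrightarrow> l) at_top"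
  proof (rule tendstoI)
    fix e :: real assume e: "e > 0"
    then obtain Y where Y: "\<And>y. y \<ge> Y \<Longrightarrow> \<bar>g y - g Y\<bar> \<le> e / 3" using oscillation[of "e / 3"] by auto
    have "\<bar>l - g Y\<bar> \<le> e / 3"
    proof (rule tendsto_upperbound)
      show "(\<lambda>n. \<bar>g (int n) - g Y\<bar>) \<longlonglongrightarrow> \<bar>l - g Y\<bar>" by (intro tendsto_intros l)
      show "\<forall>\<^sub>F n in sequentially. \<bar>g (int n) - g Y\<bar> \<le> e / 3"
        using Y by (intro eventually_sequentiallyI[of "nat Y"]) auto
    qed simp
    then have "dist (g y) l < e" if "y \<ge> Y" for y
      using Y[OF that] e unfolding dist_real_def by linarith
    then show "eventually (\<lambda>y. dist (g y) l < e) at_top" by (auto simp: eventually_at_top_linorder)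
  qed
  then show ?thesis ..
qed

end

section \<open>The gluing measure\<close>

lemma tendsto_zero_at_top_int:
  fixes h :: "int \<Rightarrow> real"
  assumes "\<And>e. e > 0 \<Longrightarrow> finite {y. e \<le> \<bar>h y\<bar>}"
  shows "(h \<longlongrightarrow> 0) at_top"
proof (rule tendstoI)
  fix e :: real assume "e > 0"
  from assms[OF this] obtain N where "\<And>y. e \<le> \<bar>h y\<bar> \<Longrightarrow> y \<le> N"
    by (metis bdd_above_finite bdd_above_def mem_Collect_eq)
  then have "dist (h y) 0 < e" if "y \<ge> N + 1" for y using that by (force simp: dist_real_def not_le[symmetric])
  then show "eventually (\<lambda>y. dist (h y) 0 < e) at_top" by (auto simp: eventually_at_top_linorder)
qed

lemma generator_reflect:
  "generator (map_pmf uminus p) (\<lambda>y. f (- y)) y = generator p f (- y)"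
  by (simp add: generator_def)

lemma centered_walk_reflect:
  assumes "centered_walk p"
  shows "centered_walk (map_pmf uminus p)"
proof -
  interpret centered_walk p by (rule assms)
  show ?thesis
  proof
    fix y :: int
    obtain xs where "set xs \<subseteq> set_pmf p" "sum_list xs = - y" using irreducible by blast
    then show "\<exists>xs. set xs \<subseteq> set_pmf (map_pmf uminus p) \<and> sum_list xs = y"
      by (intro exI[of _ "map uminus xs"]) (auto simp: uminus_sum_list_map[symmetric, of id, simplified])
  qed (use second_moment centered in simp_all)
qed

text \<open>Sums over the integers are taken along an enumeration, so that results on sequences
  apply; absolute convergence makes the order harmless.\<close>

lemma summable_pmf_enum:
  fixes \<tau> :: "nat \<Rightarrow> int" and f :: "int \<Rightarrow> real"
  assumes "bij \<tau>" "integrable (measure_pmf p) f"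
  shows "summable (\<lambda>n. pmf p (\<tau> n) * \<bar>f (\<tau> n)\<bar>)"
proof -
  have "integrable (count_space UNIV) (\<lambda>k. pmf p k * f k)"
    using assms(2) by (simp add: measure_pmf_eq_density integrable_density)
  then have "integrable (count_space UNIV) (\<lambda>n. pmf p (\<tau> n) * f (\<tau> n))"
    using integrable_bij_count_space[of \<tau> UNIV UNIV "\<lambda>k. pmf p k * f k"] assms(1) by simp
  then show ?thesis by (simp add: integrable_count_space_nat_iff abs_mult)
qed

lemma sum_pmf_shift:
  fixes x :: int
  assumes "finite S"
  shows "(\<Sum>a\<in>S. pmf p (a - x)) = measure_pmf.prob p {k. x + k \<in> S}"
proof -
  have "{k. x + k \<in> S} = (\<lambda>a. a - x) ` S" by force
  then have "measure_pmf.prob p {k. x + k \<in> S} = (\<Sum>k\<in>(\<lambda>a. a - x) ` S. pmf p k)"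
    using assms by (simp add: measure_measure_pmf_finite)
  then show ?thesis by (simp add: sum.reindex inj_on_def)
qed

context centered_walk
begin

text \<open>The increments are square summable, so Chebyshev counting bounds the number of those of
  size at least \<open>e\<close>.\<close>

lemma finite_large_increments:
  assumes "x \<notin> S" "a \<in> S" "e > 0"
  shows "finite {y. e \<le> \<bar>hit_ext p {x} S (y + 1) - hit_ext p {x} S y\<bar>}"
proof -
  obtain K where K: "K > 0" and bound': "\<forall>x S a Y. x \<notin> S \<longrightarrow> a \<in> S \<longrightarrow> finite Y \<longrightarrow>
     (\<Sum>y\<in>Y. (hit_ext p {x} S (y + 1) - hit_ext p {x} S y)\<^sup>2) \<le> K * hit_before p x S {x}"
    using square_increments_bound by blast
  have bound: "(\<Sum>y\<in>Y. (hit_ext p {x} S (y + 1) - hit_ext p {x} S y)\<^sup>2) \<le> K * hit_before p x S {x}"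
    if "finite Y" for Y
    using bound'[rule_format, OF assms(1,2) that] .
  define q where "q = hit_before p x S {x}"
  show ?thesis
  proof (rule finite_if_finite_subsets_card_bdd[THEN conjunct1])
    fix Y assume Y: "Y \<subseteq> {y. e \<le> \<bar>hit_ext p {x} S (y + 1) - hit_ext p {x} S y\<bar>}" "finite Y"
    have "real (card Y) * e\<^sup>2 = (\<Sum>y\<in>Y. e\<^sup>2)" by simp
    also have "\<dots> \<le> (\<Sum>y\<in>Y. (hit_ext p {x} S (y + 1) - hit_ext p {x} S y)\<^sup>2)"
    proof (rule sum_mono)
      fix y assume "y \<in> Y"
      then have "e \<le> \<bar>hit_ext p {x} S (y + 1) - hit_ext p {x} S y\<bar>" using Y(1) by blast
      then show "e\<^sup>2 \<le> (hit_ext p {x} S (y + 1) - hit_ext p {x} S y)\<^sup>2"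
        using \<open>e > 0\<close> abs_le_square_iff[of e "hit_ext p {x} S (y + 1) - hit_ext p {x} S y"] by simp
    qed
    also have "\<dots> \<le> K * q" unfolding q_def by (rule bound[OF Y(2)])
    finally have "real (card Y) \<le> K * q / e\<^sup>2" using \<open>e > 0\<close> by (simp add: field_simps)
    then show "card Y \<le> nat \<lfloor>K * q / e\<^sup>2\<rfloor>" by (simp add: le_nat_floor)
  qed
qed

lemma hit_ext_tendsto_at_top:
  assumes "finite S" "x \<notin> S" "a \<in> S"
  shows "\<exists>l. (hit_ext p {x} S \<longlongrightarrow> l) at_top"
proof (rule harmonic_tendsto_at_top)
  show "generator p (hit_ext p {x} S) y = 0" if "Max (insert x S) < y" for y
  proof -
    have "y \<noteq> x" "y \<notin> S" using that assms(1) by auto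
    then show ?thesis using generator_hit_ext_point[of x S a y] assms by simp
  qed
  show "((\<lambda>y. hit_ext p {x} S (y + 1) - hit_ext p {x} S y) \<longlongrightarrow> 0) at_top"
    using finite_large_increments[OF assms(2,3)] by (rule tendsto_zero_at_top_int)
qed (rule abs_hit_ext_le_1)

text \<open>Only the function is reflected, not the path space: the limit theorem asks for
  boundedness, harmonicity for the reversed steps and small increments, and all three carry
  over.\<close>

lemma hit_ext_tendsto_at_bot:
  assumes "finite S" "x \<notin> S" "a \<in> S"
  shows "\<exists>l. (hit_ext p {x} S \<longlongrightarrow> l) at_bot"
proof -
  interpret reflected: centered_walk "map_pmf uminus p"
    by (rule centered_walk_reflect) (rule centered_walk_axioms)
  define h where "h y = hit_ext p {x} S (- y)" for y
  have "\<exists>l. (h \<longlongrightarrow> l) at_top"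
  proof (rule reflected.harmonic_tendsto_at_top)
    show "generator (map_pmf uminus p) h y = 0" if "- Min (insert x S) < y" for y
    proof -
      have "- y < Min (insert x S)" using that by simp
      then have "- y \<noteq> x" "- y \<notin> S" using assms(1) by (auto simp: not_le[symmetric])
      then show ?thesis using generator_hit_ext_point[of x S a "- y"] assms
        by (simp add: h_def[abs_def] generator_reflect)
    qed
    show "((\<lambda>y. h (y + 1) - h y) \<longlongrightarrow> 0) at_top"
    proof (rule tendsto_zero_at_top_int)
      fix e :: real assume "e > 0"
      have "{y. e \<le> \<bar>h (y + 1) - h y\<bar>}
          \<subseteq> (\<lambda>y. - y - 1) ` {y. e \<le> \<bar>hit_ext p {x} S (y + 1) - hit_ext p {x} S y\<bar>}"
      proof
        fix y assume "y \<in> {y. e \<le> \<bar>h (y + 1) - h y\<bar>}"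
        then have "- y - 1 \<in> {y. e \<le> \<bar>hit_ext p {x} S (y + 1) - hit_ext p {x} S y\<bar>}"
          by (simp add: h_def abs_minus_commute add.commute)
        then show "y \<in> (\<lambda>y. - y - 1) ` {y. e \<le> \<bar>hit_ext p {x} S (y + 1) - hit_ext p {x} S y\<bar>}"
          by (intro image_eqI[of _ _ "- y - 1"]) auto
      qed
      then show "finite {y. e \<le> \<bar>h (y + 1) - h y\<bar>}"
        using finite_large_increments[OF assms(2,3) \<open>e > 0\<close>] finite_subset by blast
    qed
    show "\<bar>h y\<bar> \<le> 1" for y by (simp add: h_def abs_hit_ext_le_1)
  qed
  then show ?thesis by (simp add: h_def[abs_def] at_bot_mirror filterlim_filtermap)
qed

section \<open>Hitting probabilities from infinity and the total mass of the gluing measure\<close>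

definition hit_from_infinity :: "int \<Rightarrow> int set \<Rightarrow> int filter \<Rightarrow> real" where
  "hit_from_infinity x S F = Lim F (hit_ext p {x} S)"

lemma tendsto_hit_from_infinity:
  assumes "finite S" "x \<notin> S" "a \<in> S" "F = at_top \<or> F = at_bot"
  shows "(hit_ext p {x} S \<longlongrightarrow> hit_from_infinity x S F) F"
  using hit_ext_tendsto_at_top[OF assms(1-3)] hit_ext_tendsto_at_bot[OF assms(1-3)] assms(4)
  by (auto simp: hit_from_infinity_def tendsto_Lim)

lemma hit_before_infinity_eq:
  assumes "finite S" "x \<notin> S" "a \<in> S"
  shows "hit_before_infinity p {x} S = (hit_from_infinity x S at_top + hit_from_infinity x S at_bot) / 2"
proof -
  have fin: "finite (insert x S)" using assms by simp
  have "eventually (\<lambda>y. hit_before p y {x} S = hit_ext p {x} S y) at_top"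
    unfolding eventually_at_top_linorder
  proof (intro exI[of _ "Max (insert x S) + 1"] allI impI)
    fix y assume "Max (insert x S) + 1 \<le> y"
    then have "Max (insert x S) < y" by simp
    then have "y \<notin> insert x S" using Max_ge[OF fin] leD by blast
    then show "hit_before p y {x} S = hit_ext p {x} S y" by (auto simp: hit_ext_def)
  qed
  then have "((\<lambda>y. hit_before p y {x} S) \<longlongrightarrow> hit_from_infinity x S at_top) at_top"
    using tendsto_hit_from_infinity[OF assms, of at_top] by (simp add: tendsto_cong)
  moreover have "eventually (\<lambda>y. hit_before p y {x} S = hit_ext p {x} S y) at_bot"
    unfolding eventually_at_bot_linorder
  proof (intro exI[of _ "Min (insert x S) - 1"] allI impI)
    fix y assume "y \<le> Min (insert x S) - 1"
    then have "y < Min (insert x S)" by simp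
    then have "y \<notin> insert x S" using Min_le[OF fin] leD by blast
    then show "hit_before p y {x} S = hit_ext p {x} S y" by (auto simp: hit_ext_def)
  qed
  then have "((\<lambda>y. hit_before p y {x} S) \<longlongrightarrow> hit_from_infinity x S at_bot) at_bot"
    using tendsto_hit_from_infinity[OF assms, of at_bot] by (simp add: tendsto_cong)
  ultimately show ?thesis by (simp add: hit_before_infinity_def tendsto_Lim)
qed

lemma hit_from_infinity_le_1:
  assumes "finite S" "x \<notin> S" "a \<in> S" "F = at_top \<or> F = at_bot"
  shows "hit_from_infinity x S F \<le> 1"
proof -
  have F: "F \<noteq> bot" using assms(4) by (elim disjE) simp_all
  note lim = tendsto_hit_from_infinity[OF assms]
  show "hit_from_infinity x S F \<le> 1"
    using tendsto_upperbound[OF lim _ F, of 1] by (simp add: hit_ext_le_1)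
qed

text \<open>As \<open>1 / \<P>\<^sub>x(T\<^sub>S < T\<^sub>x)\<close> is the expected number of visits to \<open>x\<close> before \<open>T\<^sub>S\<close>, the product
  \<open>edge_rate S x * \<P>\<^sub>y(T\<^sub>x < T\<^sub>S)\<close> is the probability that the walk from \<open>y\<close> enters \<open>S\<close> by a jump from \<open>x\<close>.\<close>

definition edge_rate :: "int set \<Rightarrow> int \<Rightarrow> real" where
  "edge_rate S x = (if x \<in> S then 0 else (\<Sum>a\<in>S. pmf p (a - x)) / hit_before p x S {x})"

lemma sum_gluing_measure:
  assumes "x \<notin> S"
  shows "(\<Sum>a\<in>S. gluing_measure p x a S) = edge_rate S x * hit_before_infinity p {x} S"
  using assms by (simp add: gluing_measure_def edge_rate_def sum_divide_distrib[symmetric]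
      sum_distrib_right[symmetric] mult.commute)

lemma edge_rate_nonneg: "0 \<le> edge_rate S x"
  by (simp add: edge_rate_def sum_nonneg hit_before_nonneg)

text \<open>The escape bound is used with the very point \<open>a\<close> that the jump hits. The
  distance is then the jump length, and a finite first moment suffices for each of the finitely many
  \<open>a\<close>.\<close>

lemma summable_edge_rate:
  assumes "finite S" "bij \<sigma>"
  shows "summable (\<lambda>n. edge_rate S (\<sigma> n))"
proof -
  obtain C where C: "C > 0" and escape: "\<And>x a. x \<notin> S \<Longrightarrow> a \<in> S \<Longrightarrow>
      0 < hit_before p x S {x} \<and> 1 / hit_before p x S {x} \<le> C * real_of_int \<bar>x - a\<bar>"
    using escape_lower_bound by blast
  have le: "edge_rate S x \<le> (\<Sum>a\<in>S. C * (pmf p (a - x) * \<bar>real_of_int (a - x)\<bar>))" for x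
  proof (cases "x \<in> S")
    case False
    have "edge_rate S x = (\<Sum>a\<in>S. pmf p (a - x) * (1 / hit_before p x S {x}))"
      using False by (simp add: edge_rate_def sum_divide_distrib)
    also have "\<dots> \<le> (\<Sum>a\<in>S. pmf p (a - x) * (C * \<bar>real_of_int (a - x)\<bar>))"
      using escape[OF False] by (intro sum_mono mult_left_mono) (auto simp: abs_minus_commute)
    finally show ?thesis by (simp add: mult.left_commute)
  qed (use C in \<open>auto simp: edge_rate_def intro!: sum_nonneg mult_nonneg_nonneg\<close>)
  have "summable (\<lambda>n. \<Sum>a\<in>S. C * (pmf p (a - \<sigma> n) * \<bar>real_of_int (a - \<sigma> n)\<bar>))"
  proof (intro summable_sum summable_mult)
    fix a
    have "bij (\<lambda>n. a - \<sigma> n)"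
      using bij_comp[OF assms(2), of "\<lambda>x. a - x"]
        o_bij[of "\<lambda>x. a - x" "\<lambda>x. a - x"] by (simp add: o_def fun_eq_iff)
    from summable_pmf_enum[OF this first_moment]
    show "summable (\<lambda>n. pmf p (a - \<sigma> n) * \<bar>real_of_int (a - \<sigma> n)\<bar>)" .
  qed
  then show ?thesis
    by (rule summable_comparison_test'[where N = 0]) (use le edge_rate_nonneg in auto)
qed

text \<open>The decomposition by the last jump is verified, not derived: the series and the
  indicator of \<open>- S\<close> vanish on \<open>S\<close> and have the same generator off it, so
  the maximum principle for both signs of their difference \<open>w\<close> identifies them.\<close>

lemma hit_distribution_sum:
  assumes "finite S" "a \<in> S" "bij \<sigma>" "y \<notin> S"
  shows "(\<Sum>n. edge_rate S (\<sigma> n) * hit_ext p {\<sigma> n} S y) = 1"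
proof -
  obtain C where escape: "\<And>x a. x \<notin> S \<Longrightarrow> a \<in> S \<Longrightarrow>
      0 < hit_before p x S {x} \<and> 1 / hit_before p x S {x} \<le> C * real_of_int \<bar>x - a\<bar>"
    using escape_lower_bound by blast
  define c where "c n = edge_rate S (\<sigma> n)" for n
  define g where "g n = hit_ext p {\<sigma> n} S" for n
  have c0: "0 \<le> c n" for n by (simp add: c_def edge_rate_nonneg)
  have g0: "0 \<le> g n y" and g1: "g n y \<le> 1" for n y by (simp_all add: g_def hit_ext_nonneg hit_ext_le_1)
  have cg: "\<bar>c n * g n y\<bar> \<le> c n" for n y
    using c0[of n] g0[of n y] g1[of n y] by (simp add: abs_mult mult_left_le)
  have sumc: "summable c" unfolding c_def by (rule summable_edge_rate[OF assms(1,3)])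
  have sumcg: "summable (\<lambda>n. c n * g n y)" for y
    by (rule summable_comparison_test'[OF sumc, of 0]) (use cg in simp)
  define u where "u y = (\<Sum>n. c n * g n y)" for y
  have u_abs: "\<bar>u y\<bar> \<le> suminf c" for y
  proof -
    have "0 \<le> u y" unfolding u_def by (intro suminf_nonneg sumcg) (simp add: c0 g0)
    moreover have "u y \<le> suminf c"
      unfolding u_def by (intro suminf_le sumcg sumc) (use cg abs_le_D1 in blast)
    ultimately show ?thesis by simp
  qed
  have u_S: "u y = 0" if "y \<in> S" for y using that by (simp add: u_def g_def hit_ext_def)
  have gen_u: "generator p u y = - measure_pmf.prob p {k. y + k \<in> S}" if y: "y \<notin> S" for y
  proof -
    obtain m where m: "\<sigma> m = y" using assms(3) by (metis bij_pointE)
    have "measure_pmf.expectation p (\<lambda>k. u (y + k)) = (\<Sum>n. measure_pmf.expectation p (\<lambda>k. c n * g n (y + k)))"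
      unfolding u_def
    proof (rule integral_suminf)
      show int: "integrable (measure_pmf p) (\<lambda>k. c n * g n (y + k))" for n
        by (rule integrable_pmf_bounded[OF cg])
      show "AE k in measure_pmf p. summable (\<lambda>n. norm (c n * g n (y + k)))"
        using sumcg c0 g0 by (simp add: abs_mult)
      show "summable (\<lambda>n. measure_pmf.expectation p (\<lambda>k. norm (c n * g n (y + k))))"
      proof (rule summable_comparison_test'[OF sumc, of 0])
        fix n
        have "measure_pmf.expectation p (\<lambda>k. norm (c n * g n (y + k))) \<le> measure_pmf.expectation p (\<lambda>k. c n)"
          using int[of n] cg by (intro integral_mono integrable_norm) auto
        then show "norm (measure_pmf.expectation p (\<lambda>k. norm (c n * g n (y + k)))) \<le> c n"
          by (simp add: measure_pmf.prob_space)
      qed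
    qed
    also have "\<dots> = (\<Sum>n. c n * g n y + (if n = m then - measure_pmf.prob p {k. y + k \<in> S} else 0))"
    proof (rule suminf_cong)
      fix n
      have "measure_pmf.expectation p (\<lambda>k. c n * g n (y + k)) = c n * g n y + c n * generator p (g n) y"
        by (simp add: generator_def algebra_simps)
      \<comment> \<open>Only the site \<open>\<sigma> n\<close> equal to \<open>y\<close>
        contributes, and there the escape probability cancels the denominator of
        \<open>edge_rate\<close>.\<close>
      also have "c n * generator p (g n) y = (if n = m then - measure_pmf.prob p {k. y + k \<in> S} else 0)"
      proof (cases "\<sigma> n \<in> S")
        case True
        then show ?thesis using y m by (auto simp: c_def edge_rate_def)
      next
        case False
        have "n = m \<longleftrightarrow> y = \<sigma> n" using m assms(3) by (metis bij_pointE)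
        then show ?thesis
          using False generator_hit_ext_point[OF False assms(2) y] escape[OF False assms(2)]
          by (auto simp: c_def g_def edge_rate_def sum_pmf_shift[OF assms(1)])
      qed
      finally show "measure_pmf.expectation p (\<lambda>k. c n * g n (y + k))
        = c n * g n y + (if n = m then - measure_pmf.prob p {k. y + k \<in> S} else 0)" .
    qed
    also have "\<dots> = u y - measure_pmf.prob p {k. y + k \<in> S}"
      unfolding u_def
      using sums_add[OF summable_sums[OF sumcg[of y]] sums_single[of m "\<lambda>_. - measure_pmf.prob p {k. y + k \<in> S}"]]
      by (simp add: sums_iff)
    finally show ?thesis by (simp add: generator_def)
  qed
  define w where "w y = indicator (- S) y - u y" for y
  have w_abs: "\<bar>w y\<bar> \<le> 1 + suminf c" for y
    using u_abs[of y] by (auto simp: w_def indicator_def)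
  have w_S: "w y = 0" if "y \<in> S" for y using that by (simp add: w_def u_S)
  have gen_w: "generator p w y = 0" if y: "y \<notin> S" for y
  proof -
    have "generator p w y = generator p (indicator (- S)) y - generator p u y"
      unfolding w_def by (rule generator_diff[where B = 1, OF _ u_abs]) (simp add: indicator_def)
    also have "generator p (indicator (- S)) y = measure_pmf.expectation p (\<lambda>k. 1 - indicator {k. y + k \<in> S} k) - 1"
      using y unfolding generator_def
      by (intro arg_cong2[where f = minus] Bochner_Integration.integral_cong) (auto simp: indicator_def)
    also have "\<dots> = - measure_pmf.prob p {k. y + k \<in> S}"
      by (simp add: measure_pmf.prob_space)
    finally show ?thesis using y by (simp add: gen_u)
  qed
  have gen_w': "generator p (\<lambda>y. - w y) y = 0" if "y \<notin> S" for y
    using gen_w[OF that] by (simp add: generator_uminus)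
  have "w y \<le> 0"
    by (rule maximum_principle[of w "1 + suminf c" "- S" a]) (use w_abs w_S gen_w assms in auto)
  moreover have "- w y \<le> 0"
    by (rule maximum_principle[of "\<lambda>y. - w y" "1 + suminf c" "- S" a]) (use w_abs w_S gen_w' assms in auto)
  ultimately have "w y = 0" by simp
  then show ?thesis using assms(4) by (simp add: w_def u_def c_def g_def)
qed

lemma hit_distribution_sum_infinity:
  assumes "finite S" "a \<in> S" "bij \<sigma>" "F = at_top \<or> F = at_bot"
  shows "(\<lambda>n. edge_rate S (\<sigma> n) * hit_from_infinity (\<sigma> n) S F) sums 1"
proof -
  have F: "F \<noteq> bot" using assms(4) by (elim disjE) simp_all
  have tannery: "summable (\<lambda>n. norm (edge_rate S (\<sigma> n) * hit_from_infinity (\<sigma> n) S F)) \<and>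
    ((\<lambda>y. \<Sum>n. edge_rate S (\<sigma> n) * hit_ext p {\<sigma> n} S y)
      \<longlongrightarrow> (\<Sum>n. edge_rate S (\<sigma> n) * hit_from_infinity (\<sigma> n) S F)) F"
  proof (rule tannerys_theorem[THEN conjunct2])
    show "((\<lambda>y. edge_rate S (\<sigma> n) * hit_ext p {\<sigma> n} S y) \<longlongrightarrow> edge_rate S (\<sigma> n) * hit_from_infinity (\<sigma> n) S F) F" for n
    proof (cases "\<sigma> n \<in> S")
      case False
      then show ?thesis
        by (intro tendsto_mult_left tendsto_hit_from_infinity[OF assms(1) _ assms(2,4)])
    qed (simp add: edge_rate_def)
    show "\<forall>\<^sub>F (n, y) in sequentially \<times>\<^sub>F F. norm (edge_rate S (\<sigma> n) * hit_ext p {\<sigma> n} S y) \<le> edge_rate S (\<sigma> n)"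
      by (intro always_eventually) (auto simp: abs_mult edge_rate_nonneg hit_ext_nonneg hit_ext_le_1 mult_left_le)
  qed (use summable_edge_rate[OF assms(1,3)] F in auto)
  have "eventually (\<lambda>y. y \<notin> S) F"
    using assms(4)
  proof
    assume [simp]: "F = at_top"
    have "Max S < y \<Longrightarrow> y \<notin> S" for y using Max_ge[OF assms(1)] leD by blast
    then show ?thesis by (auto intro: eventually_mono[OF eventually_gt_at_top[of "Max S"]])
  next
    assume [simp]: "F = at_bot"
    have "y < Min S \<Longrightarrow> y \<notin> S" for y using Min_le[OF assms(1)] leD by blast
    then show ?thesis by (auto simp: eventually_at_bot_dense intro!: exI[of _ "Min S"])
  qed
  then have "eventually (\<lambda>y. (\<Sum>n. edge_rate S (\<sigma> n) * hit_ext p {\<sigma> n} S y) = 1) F"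
    by (rule eventually_mono) (rule hit_distribution_sum[OF assms(1-3)])
  then have "((\<lambda>y. \<Sum>n. edge_rate S (\<sigma> n) * hit_ext p {\<sigma> n} S y) \<longlongrightarrow> 1) F"
    by (rule tendsto_eventually)
  with tannery have "(\<Sum>n. edge_rate S (\<sigma> n) * hit_from_infinity (\<sigma> n) S F) = 1"
    using tendsto_unique[OF F] by blast
  with tannery show ?thesis by (metis summable_norm_cancel summable_sums)
qed

lemma gluing_measure_sums_1:
  assumes "finite S" "a \<in> S" "bij \<sigma>"
  shows "(\<lambda>n. if \<sigma> n \<in> S then 0 else \<Sum>a\<in>S. gluing_measure p (\<sigma> n) a S) sums 1"
proof -
  have "(\<lambda>n. (edge_rate S (\<sigma> n) * hit_from_infinity (\<sigma> n) S at_top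
      + edge_rate S (\<sigma> n) * hit_from_infinity (\<sigma> n) S at_bot) / 2) sums ((1 + 1) / 2)"
    by (intro sums_divide sums_add hit_distribution_sum_infinity[OF assms]) auto
  moreover have "(edge_rate S (\<sigma> n) * hit_from_infinity (\<sigma> n) S at_top
      + edge_rate S (\<sigma> n) * hit_from_infinity (\<sigma> n) S at_bot) / 2
    = (if \<sigma> n \<in> S then 0 else \<Sum>a\<in>S. gluing_measure p (\<sigma> n) a S)" for n
  proof (cases "\<sigma> n \<in> S")
    case False
    then show ?thesis
      by (simp add: sum_gluing_measure hit_before_infinity_eq[OF assms(1) _ assms(2)] algebra_simps add_divide_distrib)
  qed (simp add: edge_rate_def)
  ultimately show ?thesis by simp
qed

text \<open>With \<open>a\<close> nearest to \<open>x\<close>, entering \<open>S\<close> in one step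
  takes a jump of length at least |x - a|; the escape bound gives the linear factor, and the
  probability from infinity is at most 1.\<close>

lemma gluing_measure_bound:
  "\<exists>C>0. \<forall>S x a. finite S \<longrightarrow> x \<notin> S \<longrightarrow> a \<in> S \<longrightarrow> (\<forall>b\<in>S. \<bar>x - a\<bar> \<le> \<bar>x - b\<bar>) \<longrightarrow>
    (\<Sum>a\<in>S. gluing_measure p x a S)
      \<le> C * real_of_int \<bar>x - a\<bar> * measure_pmf.prob p {k. \<bar>x - a\<bar> \<le> \<bar>k\<bar>}"
proof -
  obtain C where C: "C > 0" and escape: "\<And>x S a. x \<notin> S \<Longrightarrow> a \<in> S \<Longrightarrow>
      0 < hit_before p x S {x} \<and> 1 / hit_before p x S {x} \<le> C * real_of_int \<bar>x - a\<bar>"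
    using escape_lower_bound by blast
  show ?thesis
  proof (intro exI[of _ C] conjI allI impI C)
    fix S :: "int set" and x a
    assume S: "finite S" "x \<notin> S" "a \<in> S" and near: "\<forall>b\<in>S. \<bar>x - a\<bar> \<le> \<bar>x - b\<bar>"
    let ?T = "measure_pmf.prob p {k. \<bar>x - a\<bar> \<le> \<bar>k\<bar>}"
    have "hit_before_infinity p {x} S \<le> 1"
      using hit_from_infinity_le_1[OF S, of at_top] hit_from_infinity_le_1[OF S, of at_bot]
      by (simp add: hit_before_infinity_eq[OF S])
    then have "(\<Sum>a\<in>S. gluing_measure p x a S) \<le> edge_rate S x"
      using S(2) edge_rate_nonneg[of S x] by (simp add: sum_gluing_measure mult_left_le)
    also have "\<dots> = measure_pmf.prob p {k. x + k \<in> S} * (1 / hit_before p x S {x})"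
      using S by (simp add: edge_rate_def sum_pmf_shift)
    also have "\<dots> \<le> ?T * (C * real_of_int \<bar>x - a\<bar>)"
    proof (intro mult_mono)
      show "measure_pmf.prob p {k. x + k \<in> S} \<le> ?T"
      proof (intro measure_pmf.finite_measure_mono subsetI)
        fix k assume "k \<in> {k. x + k \<in> S}"
        then have "\<bar>x - a\<bar> \<le> \<bar>x - (x + k)\<bar>" using near by blast
        then show "k \<in> {k. \<bar>x - a\<bar> \<le> \<bar>k\<bar>}" by simp
      qed simp
    qed (use escape[OF S(2,3)] in auto)
    finally show "(\<Sum>a\<in>S. gluing_measure p x a S) \<le> C * real_of_int \<bar>x - a\<bar> * ?T"
      by (simp add: mult_ac)
  qed
qed

end

section \<open>Linear growth of sums of dominated increments\<close>

text \<open>Scales 2^k below \<open>m\<close> contribute a geometric sum of at most 2m; the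
  remaining ones contribute m^2 / 2^k each, again at most 2m in total.\<close>

lemma dyadic_weight_sum:
  fixes m :: nat
  defines "b \<equiv> \<lambda>N. if m \<le> N then (real m)\<^sup>2 / real N else real N"
  shows "(\<Sum>k<K. b (2 ^ k)) \<le> 4 * real m"
proof (cases "m = 0")
  case False
  \<comment> \<open>The subtracted term is the geometric tail of m^2 / 2^k over k >= K, reserved in
    the invariant for the scales still to come.\<close>
  have main: "(2 ^ K < m \<longrightarrow> (\<Sum>k<K. b (2 ^ k)) \<le> 2 ^ K) \<and>
    (m \<le> 2 ^ K \<longrightarrow> (\<Sum>k<K. b (2 ^ k)) \<le> 4 * real m - 2 * (real m)\<^sup>2 / 2 ^ K)"
  proof (induction K)
    case 0
    then show ?case using False by (auto simp: le_Suc_eq)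
  next
    case (Suc K)
    show ?case
    proof (cases "m \<le> 2 ^ K")
      case True
      then have "(\<Sum>k<Suc K. b (2 ^ k)) \<le> 4 * real m - 2 * (real m)\<^sup>2 / 2 ^ K + (real m)\<^sup>2 / 2 ^ K"
        using Suc by (simp add: b_def)
      also have "\<dots> = 4 * real m - 2 * (real m)\<^sup>2 / 2 ^ Suc K" by (simp add: field_simps)
      finally show ?thesis using True by auto
    next
      case less: False
      then have le: "(\<Sum>k<Suc K. b (2 ^ k)) \<le> 2 ^ Suc K" using Suc by (simp add: b_def)
      have "(\<Sum>k<Suc K. b (2 ^ k)) \<le> 4 * real m - 2 * (real m)\<^sup>2 / 2 ^ Suc K" if m: "m \<le> 2 ^ Suc K"
      proof -
        have "real m \<le> real (2 ^ Suc K)" unfolding of_nat_le_iff by (rule m)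
        then have "real m \<le> 2 ^ Suc K" by simp
        then have "real m * real m \<le> real m * 2 ^ Suc K" by (intro mult_left_mono) auto
        then have "2 * (real m)\<^sup>2 / 2 ^ Suc K \<le> 2 * real m" by (simp add: field_simps power2_eq_square)
        moreover have "real (2 ^ K) \<le> real m" unfolding of_nat_le_iff using less by simp
        then have "2 ^ Suc K \<le> 2 * real m" by (simp only: of_nat_power of_nat_numeral power_Suc)
        ultimately show ?thesis using le by linarith
      qed
      with le show ?thesis by simp
    qed
  qed
  show ?thesis
  proof (cases "m \<le> 2 ^ K")
    case True
    then have "(\<Sum>k<K. b (2 ^ k)) \<le> 4 * real m - 2 * (real m)\<^sup>2 / 2 ^ K" using main by blast
    moreover have "0 \<le> 2 * (real m)\<^sup>2 / 2 ^ K" by simp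
    ultimately show ?thesis by linarith
  next
    case False
    then have "(\<Sum>k<K. b (2 ^ k)) \<le> 2 ^ K" using main by simp
    moreover have "real (2 ^ K) \<le> real m" unfolding of_nat_le_iff using False by simp
    then have "2 ^ K \<le> real m" by (simp only: of_nat_power of_nat_numeral)
    ultimately show ?thesis by linarith
  qed
qed (simp add: b_def)

text \<open>\<open>H n\<close> is the history of a process before its \<open>n\<close>-th increment \<open>\<Delta> n\<close>.\<close>

locale dominated_increments = prob_space M for M :: "'w measure" +
  fixes H :: "nat \<Rightarrow> 'w \<Rightarrow> 'h :: countable" and \<Delta> :: "nat \<Rightarrow> 'w \<Rightarrow> nat"
    and d :: "nat \<Rightarrow> 'h \<Rightarrow> nat" and w :: "nat \<Rightarrow> real"
  assumes measurable_H [measurable]: "\<And>n. H n \<in> M \<rightarrow>\<^sub>M count_space UNIV"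
    and measurable_\<Delta> [measurable]: "\<And>n. \<Delta> n \<in> M \<rightarrow>\<^sub>M count_space UNIV"
    and adapted: "\<And>i n \<omega>. i < n \<Longrightarrow> \<omega> \<in> space M \<Longrightarrow> \<Delta> i \<omega> = d i (H n \<omega>)"
    and dominated: "\<And>n m h. 0 < m \<Longrightarrow>
      prob {\<omega> \<in> space M. H n \<omega> = h \<and> \<Delta> n \<omega> = m} \<le> w m * prob {\<omega> \<in> space M. H n \<omega> = h}"
    and w_nonneg: "\<And>m. 0 \<le> w m"
    and summable_mean: "summable (\<lambda>m. real m * w m)"
begin

text \<open>The bound on atoms is integrated against a function of the history; as histories are
  countable, both sides split into sums over atoms numbered by \<open>to_nat\<close>.\<close>

lemma expectation_increment_le:
  assumes \<phi>: "\<And>h. 0 \<le> \<phi> h" "\<And>h. \<phi> h \<le> (B::real)" and "0 < m"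
  shows "expectation (\<lambda>\<omega>. \<phi> (H n \<omega>) * indicator {\<omega>. \<Delta> n \<omega> = m} \<omega>) \<le> w m * expectation (\<lambda>\<omega>. \<phi> (H n \<omega>))"
proof -
  have meas [measurable]: "(\<lambda>\<omega>. \<phi> (H n \<omega>)) \<in> borel_measurable M"
    by (rule measurable_compose[OF measurable_H]) simp
  define X where "X k = {\<omega> \<in> space M. to_nat (H n \<omega>) = k \<and> \<Delta> n \<omega> = m}" for k
  define Y where "Y k = {\<omega> \<in> space M. to_nat (H n \<omega>) = k}" for k
  have [measurable]: "X k \<in> sets M" "Y k \<in> sets M" for k unfolding X_def Y_def by measurable
  have "emeasure M (X k) \<le> ennreal (w m) * emeasure M (Y k)" for k
  proof (cases "k \<in> range (to_nat :: 'h \<Rightarrow> nat)")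
    case True
    then obtain h :: 'h where k: "k = to_nat h" by blast
    have "prob (X k) \<le> w m * prob (Y k)"
      using dominated[OF \<open>0 < m\<close>, of n h] by (simp add: X_def Y_def k)
    then show ?thesis
      by (simp add: emeasure_eq_measure ennreal_mult[symmetric] w_nonneg ennreal_leI)
  next
    case False
    then have "X k = {}" by (auto simp: X_def)
    then show ?thesis by simp
  qed
  note X_le_Y = this
  have disj: "disjoint_family X" "disjoint_family Y" by (auto simp: disjoint_family_on_def X_def Y_def)
  let ?f = "\<lambda>k. ennreal (\<phi> (from_nat k))"
  have "(\<integral>\<^sup>+\<omega>. ennreal (\<phi> (H n \<omega>) * indicator {\<omega>. \<Delta> n \<omega> = m} \<omega>) \<partial>M)
     = (\<integral>\<^sup>+\<omega>. (\<Sum>k. ?f k * indicator (X k) \<omega>) \<partial>M)"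
  proof (rule nn_integral_cong)
    fix \<omega> assume \<omega>: "\<omega> \<in> space M"
    show "ennreal (\<phi> (H n \<omega>) * indicator {\<omega>. \<Delta> n \<omega> = m} \<omega>) = (\<Sum>k. ?f k * indicator (X k) \<omega>)"
    proof (cases "\<Delta> n \<omega> = m")
      case True
      then have "\<omega> \<in> X (to_nat (H n \<omega>))" using \<omega> by (simp add: X_def)
      from suminf_cmult_indicator[OF disj(1) this, of ?f] show ?thesis using True by simp
    qed (simp add: X_def)
  qed
  also have "\<dots> = (\<Sum>k. ?f k * emeasure M (X k))"
    by (simp add: nn_integral_suminf nn_integral_cmult_indicator)
  also have "\<dots> \<le> (\<Sum>k. ennreal (w m) * (?f k * emeasure M (Y k)))"
  proof (intro suminf_le)
    fix k
    have "?f k * emeasure M (X k) \<le> ?f k * (ennreal (w m) * emeasure M (Y k))"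
      by (intro mult_left_mono X_le_Y) simp
    then show "?f k * emeasure M (X k) \<le> ennreal (w m) * (?f k * emeasure M (Y k))"
      by (simp add: mult.left_commute)
  qed auto
  also have "\<dots> = ennreal (w m) * (\<integral>\<^sup>+\<omega>. (\<Sum>k. ?f k * indicator (Y k) \<omega>) \<partial>M)"
    by (simp add: nn_integral_suminf nn_integral_cmult_indicator)
  also have "(\<integral>\<^sup>+\<omega>. (\<Sum>k. ?f k * indicator (Y k) \<omega>) \<partial>M) = (\<integral>\<^sup>+\<omega>. ennreal (\<phi> (H n \<omega>)) \<partial>M)"
  proof (rule nn_integral_cong)
    fix \<omega> assume "\<omega> \<in> space M"
    then have "\<omega> \<in> Y (to_nat (H n \<omega>))" by (simp add: Y_def)
    from suminf_cmult_indicator[OF disj(2) this, of ?f]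
    show "(\<Sum>k. ?f k * indicator (Y k) \<omega>) = ennreal (\<phi> (H n \<omega>))" by simp
  qed
  also have "\<dots> = ennreal (expectation (\<lambda>\<omega>. \<phi> (H n \<omega>)))"
    using \<phi> by (intro nn_integral_eq_integral integrable_const_bound[where B = B]) auto
  also have "(\<integral>\<^sup>+\<omega>. ennreal (\<phi> (H n \<omega>) * indicator {\<omega>. \<Delta> n \<omega> = m} \<omega>) \<partial>M)
     = ennreal (expectation (\<lambda>\<omega>. \<phi> (H n \<omega>) * indicator {\<omega>. \<Delta> n \<omega> = m} \<omega>))"
  proof (intro nn_integral_eq_integral integrable_const_bound[where B = B])
    have "\<Delta> n -` {m} \<inter> space M \<in> sets M" by measurable
    moreover have "\<Delta> n -` {m} \<inter> space M = {\<omega>. \<Delta> n \<omega> = m} \<inter> space M" by auto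
    ultimately show "(\<lambda>\<omega>. \<phi> (H n \<omega>) * indicator {\<omega>. \<Delta> n \<omega> = m} \<omega>) \<in> borel_measurable M"
      by (intro borel_measurable_times meas) (simp add: borel_measurable_indicator_iff)
    have "0 \<le> B" using \<phi>(1,2) order_trans by blast
    then show "AE \<omega> in M. norm (\<phi> (H n \<omega>) * indicator {\<omega>. \<Delta> n \<omega> = m} \<omega>) \<le> B"
      using \<phi> by (intro AE_I2) (auto simp: indicator_def)
  qed (use \<phi> in \<open>auto simp: indicator_def\<close>)
  finally have "ennreal (expectation (\<lambda>\<omega>. \<phi> (H n \<omega>) * indicator {\<omega>. \<Delta> n \<omega> = m} \<omega>))
     \<le> ennreal (w m * expectation (\<lambda>\<omega>. \<phi> (H n \<omega>)))"
    by (simp add: ennreal_mult' w_nonneg)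
  moreover have "0 \<le> w m * expectation (\<lambda>\<omega>. \<phi> (H n \<omega>))" using \<phi> by (simp add: w_nonneg)
  ultimately show ?thesis by (simp add: ennreal_le_iff)
qed

lemma prob_increment_le:
  assumes "0 < m"
  shows "prob {\<omega> \<in> space M. \<Delta> n \<omega> = m} \<le> w m"
proof -
  have "{\<omega> \<in> space M. \<Delta> n \<omega> = m} = {\<omega>. \<Delta> n \<omega> = m} \<inter> space M" by auto
  then show ?thesis
    using expectation_increment_le[of "\<lambda>_. 1" 1 m n] assms
    by (simp add: prob_space)
qed

text \<open>Bounds the conditional mean of every increment; \<open>w\<close> is a dominating weight
  and need not be a probability.\<close>

definition \<kappa> :: real where "\<kappa> = (\<Sum>m. real m * w m)"

lemma \<kappa>_nonneg: "0 \<le> \<kappa>"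
  unfolding \<kappa>_def by (intro suminf_nonneg summable_mean) (simp add: w_nonneg)

definition truncated :: "nat \<Rightarrow> nat \<Rightarrow> nat" where
  "truncated N m = (if m \<le> N then m else 0)"

definition excess :: "nat \<Rightarrow> nat \<Rightarrow> 'w \<Rightarrow> real" where
  "excess N n \<omega> = max 0 (real (\<Sum>i<n. truncated N (\<Delta> i \<omega>)) - \<kappa> * real n)"

lemma truncated_le: "truncated N m \<le> N" by (simp add: truncated_def)

lemma excess_bounds: "0 \<le> excess N n \<omega>" "excess N n \<omega> \<le> real (n * N)"
proof -
  have "(\<Sum>i<n. truncated N (\<Delta> i \<omega>)) \<le> n * N"
    using sum_bounded_above[of "{..<n}" "\<lambda>i. truncated N (\<Delta> i \<omega>)" N] truncated_le by simp
  then have "real (\<Sum>i<n. truncated N (\<Delta> i \<omega>)) \<le> real (n * N)" by (simp only: of_nat_le_iff)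
  moreover have "0 \<le> \<kappa> * real n" by (simp add: \<kappa>_nonneg)
  ultimately show "excess N n \<omega> \<le> real (n * N)" unfolding excess_def by simp
qed (simp add: excess_def)

lemma measurable_excess [measurable]: "excess N n \<in> borel_measurable M"
proof -
  have "(\<lambda>\<omega>. real (truncated N (\<Delta> i \<omega>))) \<in> borel_measurable M" for i
    by (rule measurable_compose[OF measurable_\<Delta>]) simp
  then show ?thesis unfolding excess_def[abs_def] of_nat_sum by measurable
qed

lemma truncated_eq_sum:
  fixes f :: "nat \<Rightarrow> real"
  assumes "f 0 = 0"
  shows "f (truncated N m) = (\<Sum>j\<in>{1..N}. f j * (if m = j then 1 else 0))"
proof -
  have "(\<Sum>j\<in>{1..N}. f j * (if m = j then 1 else 0)) = (\<Sum>j\<in>{1..N}. if m = j then f j else 0)"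
    by (intro sum.cong) auto
  also have "\<dots> = f (truncated N m)" using assms by (cases "m = 0") (auto simp: truncated_def)
  finally show ?thesis by simp
qed

text \<open>The centred truncated sum is a supermartingale, and \<open>excess\<close> is its positive part.\<close>

lemma expectation_excess_square:
  "expectation (\<lambda>\<omega>. (excess N n \<omega>)\<^sup>2) \<le> real n * ((\<Sum>m\<in>{1..N}. (real m)\<^sup>2 * w m) + \<kappa>\<^sup>2)"
proof (induction n)
  case 0
  then show ?case by (simp add: excess_def)
next
  case (Suc n)
  define v where "v = (\<Sum>m\<in>{1..N}. (real m)\<^sup>2 * w m)"
  \<comment> \<open>The cap \<open>real (n * N)\<close> keeps \<open>\<phi>\<close> bounded on all
    histories, as \<open>expectation_increment_le\<close> demands; on histories that occur it is
    inactive.\<close>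
  define \<phi> where "\<phi> h = min (real (n * N)) (max 0 (real (\<Sum>i<n. truncated N (d i h)) - \<kappa> * real n))" for h
  have excess_eq: "excess N n \<omega> = \<phi> (H n \<omega>)" if "\<omega> \<in> space M" for \<omega>
  proof -
    have "(\<Sum>i<n. truncated N (\<Delta> i \<omega>)) = (\<Sum>i<n. truncated N (d i (H n \<omega>)))"
      using adapted[OF _ that] by (intro sum.cong) auto
    then show ?thesis using excess_bounds[where N = N and n = n and \<omega> = \<omega>] by (simp add: \<phi>_def excess_def)
  qed
  have \<phi>: "0 \<le> \<phi> h" "\<phi> h \<le> real (n * N)" for h by (simp_all add: \<phi>_def)
  let ?t = "\<lambda>\<omega>. real (truncated N (\<Delta> n \<omega>))"
  let ?I = "\<lambda>m. indicator {\<omega>. \<Delta> n \<omega> = m} :: 'w \<Rightarrow> real"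
  have t_meas [measurable]: "?t \<in> borel_measurable M"
    by (rule measurable_compose[OF measurable_\<Delta>]) simp
  have I_meas: "?I m \<in> borel_measurable M" for m
  proof -
    have "\<Delta> n -` {m} \<inter> space M \<in> sets M" by measurable
    moreover have "\<Delta> n -` {m} \<inter> space M = {\<omega>. \<Delta> n \<omega> = m} \<inter> space M" by auto
    ultimately show ?thesis by (simp add: borel_measurable_indicator_iff)
  qed
  have I_eq: "?I m \<omega> = (if \<Delta> n \<omega> = m then 1 else 0)" for m \<omega> by (simp add: indicator_def)
  have int_excess: "integrable M (excess N n)"
    using excess_bounds[where N = N and n = n] by (intro integrable_const_bound[where B = "real (n * N)"]) auto
  have int_excess2: "integrable M (\<lambda>\<omega>. (excess N n \<omega>)\<^sup>2)"
    using excess_bounds[where N = N and n = n]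
    by (intro integrable_const_bound[where B = "(real (n * N))\<^sup>2"]) (auto intro!: power_mono)
  have int_t2: "integrable M (\<lambda>\<omega>. (?t \<omega>)\<^sup>2)"
    using truncated_le[of N] by (intro integrable_const_bound[where B = "(real N)\<^sup>2"]) (auto intro!: power_mono)
  have int_et: "integrable M (\<lambda>\<omega>. excess N n \<omega> * ?t \<omega>)"
    using excess_bounds[where N = N and n = n] truncated_le[of N]
    by (intro integrable_const_bound[where B = "real (n * N) * real N"]) (auto simp: abs_mult intro!: mult_mono)
  have int_eI: "integrable M (\<lambda>\<omega>. excess N n \<omega> * ?I m \<omega>)" for m
    using excess_bounds[where N = N and n = n] I_meas[of m]
    by (intro integrable_const_bound[where B = "real (n * N)"]) (auto simp: indicator_def)
  have int_I: "integrable M (?I m)" for m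
    using I_meas[of m] by (intro integrable_const_bound[where B = 1]) (auto simp: indicator_def)
  \<comment> \<open>Domination bounds the cross term by what the centring subtracts, so each step
    adds at most \<open>v + \<kappa>\<^sup>2\<close> to the second moment.\<close>
  have et: "expectation (\<lambda>\<omega>. excess N n \<omega> * ?t \<omega>) \<le> \<kappa> * expectation (excess N n)"
  proof -
    have "excess N n \<omega> * ?t \<omega> = (\<Sum>m\<in>{1..N}. real m * (excess N n \<omega> * ?I m \<omega>))" for \<omega>
      using truncated_eq_sum[of real N "\<Delta> n \<omega>"]
      by (simp add: sum_distrib_left I_eq mult.left_commute)
    then have "expectation (\<lambda>\<omega>. excess N n \<omega> * ?t \<omega>)
        = (\<Sum>m\<in>{1..N}. real m * expectation (\<lambda>\<omega>. excess N n \<omega> * ?I m \<omega>))"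
      using int_eI by simp
    also have "\<dots> \<le> (\<Sum>m\<in>{1..N}. real m * (w m * expectation (excess N n)))"
    proof (intro sum_mono mult_left_mono)
      fix m assume "m \<in> {1..N}"
      then have "expectation (\<lambda>\<omega>. \<phi> (H n \<omega>) * ?I m \<omega>) \<le> w m * expectation (\<lambda>\<omega>. \<phi> (H n \<omega>))"
        by (intro expectation_increment_le[OF \<phi>]) simp
      then show "expectation (\<lambda>\<omega>. excess N n \<omega> * ?I m \<omega>) \<le> w m * expectation (excess N n)"
        using excess_eq by (simp cong: Bochner_Integration.integral_cong)
    qed simp
    also have "\<dots> = (\<Sum>m\<in>{1..N}. real m * w m) * expectation (excess N n)"
      by (simp add: sum_distrib_right mult.assoc)
    also have "\<dots> \<le> \<kappa> * expectation (excess N n)"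
      unfolding \<kappa>_def using excess_bounds[where N = N and n = n]
      by (intro mult_right_mono sum_le_suminf summable_mean) (auto simp: w_nonneg)
    finally show ?thesis .
  qed
  have tt: "expectation (\<lambda>\<omega>. (?t \<omega>)\<^sup>2) \<le> v"
  proof -
    have eq: "(?t \<omega>)\<^sup>2 = (\<Sum>m\<in>{1..N}. (real m)\<^sup>2 * ?I m \<omega>)" for \<omega>
      using truncated_eq_sum[of "\<lambda>m. (real m)\<^sup>2" N "\<Delta> n \<omega>"]
      by (simp add: I_eq)
    have "expectation (\<lambda>\<omega>. (?t \<omega>)\<^sup>2) = (\<Sum>m\<in>{1..N}. (real m)\<^sup>2 * expectation (?I m))"
      unfolding eq using int_I by (subst Bochner_Integration.integral_sum) simp_all
    also have "\<dots> \<le> v"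
      unfolding v_def
    proof (intro sum_mono mult_left_mono)
      fix m assume "m \<in> {1..N}"
      then show "expectation (?I m) \<le> w m"
        using expectation_increment_le[of "\<lambda>_. 1" 1 m n] by (simp add: prob_space)
    qed simp
    finally show ?thesis .
  qed
  have step: "(excess N (Suc n) \<omega>)\<^sup>2
     \<le> (excess N n \<omega>)\<^sup>2 + 2 * (excess N n \<omega> * ?t \<omega>) - 2 * \<kappa> * excess N n \<omega> + (?t \<omega>)\<^sup>2 + \<kappa>\<^sup>2" for \<omega>
  proof -
    \<comment> \<open>Raising a negative centred sum to 0 only increases what the next step reaches;
      the absolute value covers a step that falls below 0.\<close>
    have "excess N (Suc n) \<omega> \<le> \<bar>excess N n \<omega> + ?t \<omega> - \<kappa>\<bar>"
      by (auto simp: excess_def algebra_simps max_def)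
    then have "(excess N (Suc n) \<omega>)\<^sup>2 \<le> (excess N n \<omega> + ?t \<omega> - \<kappa>)\<^sup>2"
      using abs_le_square_iff[of "excess N (Suc n) \<omega>" "excess N n \<omega> + ?t \<omega> - \<kappa>"]
        excess_bounds(1)[of N "Suc n" \<omega>] by simp
    also have "\<dots> = (excess N n \<omega>)\<^sup>2 + 2 * (excess N n \<omega> * ?t \<omega>) - 2 * \<kappa> * excess N n \<omega> + (?t \<omega>)\<^sup>2 + \<kappa>\<^sup>2
        - 2 * \<kappa> * ?t \<omega>"
      by (simp add: power2_eq_square algebra_simps)
    also have "\<dots> \<le> (excess N n \<omega>)\<^sup>2 + 2 * (excess N n \<omega> * ?t \<omega>) - 2 * \<kappa> * excess N n \<omega> + (?t \<omega>)\<^sup>2 + \<kappa>\<^sup>2"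
      using \<kappa>_nonneg by simp
    finally show ?thesis .
  qed
  have "expectation (\<lambda>\<omega>. (excess N (Suc n) \<omega>)\<^sup>2)
     \<le> expectation (\<lambda>\<omega>. (excess N n \<omega>)\<^sup>2 + 2 * (excess N n \<omega> * ?t \<omega>) - 2 * \<kappa> * excess N n \<omega> + (?t \<omega>)\<^sup>2 + \<kappa>\<^sup>2)"
  proof (rule integral_mono)
    show "integrable M (\<lambda>\<omega>. (excess N (Suc n) \<omega>)\<^sup>2)"
      using excess_bounds[where N = N and n = "Suc n"]
      by (intro integrable_const_bound[where B = "(real (Suc n * N))\<^sup>2"]) (auto intro!: power_mono simp del: of_nat_mult)
  qed (use int_excess int_excess2 int_et int_t2 step in auto)
  also have "\<dots> = expectation (\<lambda>\<omega>. (excess N n \<omega>)\<^sup>2) + 2 * expectation (\<lambda>\<omega>. excess N n \<omega> * ?t \<omega>)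
      - 2 * \<kappa> * expectation (excess N n) + expectation (\<lambda>\<omega>. (?t \<omega>)\<^sup>2) + \<kappa>\<^sup>2"
    using int_excess int_excess2 int_et int_t2 by (simp add: prob_space)
  also have "\<dots> \<le> real n * (v + \<kappa>\<^sup>2) + v + \<kappa>\<^sup>2" using Suc et tt by (simp add: v_def)
  finally show ?case by (simp add: v_def algebra_simps)
qed

section \<open>Dyadic scales and Borel-Cantelli\<close>

definition total :: "nat \<Rightarrow> 'w \<Rightarrow> nat" where "total n \<omega> = (\<Sum>i<n. \<Delta> i \<omega>)"

lemma summable_w: "summable w"
proof (rule summable_comparison_test_ev[OF _ summable_mean])
  show "\<forall>\<^sub>F m in sequentially. norm (w m) \<le> real m * w m"
    by (intro eventually_sequentiallyI[of 1])
      (use w_nonneg mult_right_mono[of 1 _ "w _"] in fastforce)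
qed

text \<open>Cost of an increment \<open>m\<close> at scale \<open>N\<close>: up to \<open>N\<close>
  its share m^2 / N in the Chebyshev bound for the truncated sum, above \<open>N\<close> the factor
  \<open>N\<close> of the union bound over the first \<open>N\<close> increments.\<close>

definition weight :: "nat \<Rightarrow> nat \<Rightarrow> real" where
  "weight N m = (if m \<le> N then (real m)\<^sup>2 / real N else real N)"

lemma weight_nonneg: "0 \<le> weight N m" by (simp add: weight_def)

lemma weight_le: "0 < N \<Longrightarrow> weight N m \<le> real m"
  by (auto simp: weight_def field_simps power2_eq_square intro!: mult_right_mono)

lemma summable_weight: "0 < N \<Longrightarrow> summable (\<lambda>m. weight N m * w m)"
  by (rule summable_comparison_test'[OF summable_mean, of 0])
    (auto simp: weight_nonneg w_nonneg abs_mult intro!: mult_right_mono weight_le)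

lemma prob_large_increment:
  "prob {\<omega> \<in> space M. N < \<Delta> n \<omega>} \<le> (\<Sum>m. w (m + Suc N))"
proof -
  have "(\<lambda>m. prob {\<omega> \<in> space M. \<Delta> n \<omega> = m + Suc N}) sums
      prob (\<Union>m. {\<omega> \<in> space M. \<Delta> n \<omega> = m + Suc N})"
    by (intro finite_measure_UNION) (auto simp: disjoint_family_on_def)
  moreover have "(\<Union>m. {\<omega> \<in> space M. \<Delta> n \<omega> = m + Suc N}) = {\<omega> \<in> space M. N < \<Delta> n \<omega>}"
    by (auto simp: less_iff_Suc_add)
  ultimately have "(\<lambda>m. prob {\<omega> \<in> space M. \<Delta> n \<omega> = m + Suc N}) sums prob {\<omega> \<in> space M. N < \<Delta> n \<omega>}"
    by simp
  moreover have "(\<lambda>m. w (m + Suc N)) sums (\<Sum>m. w (m + Suc N))"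
    using summable_w by (intro summable_sums) (simp only: summable_iff_shift)
  ultimately show ?thesis
    by (rule sums_le[rotated]) (rule prob_increment_le, simp)
qed

text \<open>Either one of the first \<open>N\<close> increments exceeds \<open>N\<close>, or
  truncation changes nothing and \<open>excess N N\<close> is at least \<open>N\<close>. A union
  bound and Markov's inequality for the square treat the two cases.\<close>

lemma prob_total_large:
  assumes "0 < N"
  shows "prob {\<omega> \<in> space M. (\<kappa> + 1) * real N \<le> real (total N \<omega>)} \<le> (\<Sum>m. weight N m * w m) + \<kappa>\<^sup>2 / real N"
proof -
  define v where "v = (\<Sum>m\<in>{1..N}. (real m)\<^sup>2 * w m)"
  define E where "E = {\<omega> \<in> space M. (real N)\<^sup>2 \<le> (excess N N \<omega>)\<^sup>2}"
  define J where "J i = {\<omega> \<in> space M. N < \<Delta> i \<omega>}" for i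
  have [measurable]: "E \<in> sets M" "J i \<in> sets M" for i unfolding E_def J_def by measurable
  have "{\<omega> \<in> space M. (\<kappa> + 1) * real N \<le> real (total N \<omega>)} \<subseteq> E \<union> (\<Union>i<N. J i)"
  proof
    fix \<omega> assume \<omega>: "\<omega> \<in> {\<omega> \<in> space M. (\<kappa> + 1) * real N \<le> real (total N \<omega>)}"
    show "\<omega> \<in> E \<union> (\<Union>i<N. J i)"
    proof (cases "\<exists>i<N. N < \<Delta> i \<omega>")
      case False
      then have "truncated N (\<Delta> i \<omega>) = \<Delta> i \<omega>" if "i < N" for i
        using that by (auto simp: truncated_def)
      then have "total N \<omega> = (\<Sum>i<N. truncated N (\<Delta> i \<omega>))"
        unfolding total_def by (intro sum.cong) auto
      then have "real N \<le> excess N N \<omega>" using \<omega> by (simp add: excess_def algebra_simps)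
      then show ?thesis using \<omega> by (auto simp: E_def intro!: power_mono)
    qed (use \<omega> in \<open>auto simp: J_def\<close>)
  qed
  then have "prob {\<omega> \<in> space M. (\<kappa> + 1) * real N \<le> real (total N \<omega>)} \<le> prob (E \<union> (\<Union>i<N. J i))"
    by (rule finite_measure_mono) measurable
  also have "\<dots> \<le> prob E + prob (\<Union>i<N. J i)" by (intro measure_Un_le) measurable
  also have "prob (\<Union>i<N. J i) \<le> (\<Sum>i<N. prob (J i))" by (intro finite_measure_subadditive_finite) auto
  also have "\<dots> \<le> real N * (\<Sum>m. w (m + Suc N))"
    using sum_bounded_above[of "{..<N}" "\<lambda>i. prob (J i)"] prob_large_increment by (simp add: J_def)
  also have "prob E \<le> expectation (\<lambda>\<omega>. (excess N N \<omega>)\<^sup>2) / (real N)\<^sup>2"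
    unfolding E_def
  proof (rule integral_Markov_inequality_measure)
    show "integrable M (\<lambda>\<omega>. (excess N N \<omega>)\<^sup>2)"
      using excess_bounds[where N = N and n = N]
      by (intro integrable_const_bound[where B = "(real (N * N))\<^sup>2"]) (auto intro!: power_mono simp del: of_nat_mult)
  qed (use assms in auto)
  also have "\<dots> \<le> (real N * (v + \<kappa>\<^sup>2)) / (real N)\<^sup>2"
    using expectation_excess_square[of N N] by (intro divide_right_mono) (simp_all add: v_def)
  also have "\<dots> = v / real N + \<kappa>\<^sup>2 / real N" using assms by (simp add: power2_eq_square field_simps)
  also have "v / real N = (\<Sum>m<Suc N. weight N m * w m)"
  proof -
    have "{..<Suc N} = insert 0 {1..N}" by auto
    then have "(\<Sum>m<Suc N. weight N m * w m) = (\<Sum>m\<in>{1..N}. weight N m * w m)"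
      by (simp add: weight_def)
    also have "\<dots> = v / real N"
      unfolding v_def sum_divide_distrib by (intro sum.cong) (auto simp: weight_def)
    finally show ?thesis by simp
  qed
  also have "real N * (\<Sum>m. w (m + Suc N)) = (\<Sum>m. weight N (m + Suc N) * w (m + Suc N))"
    using summable_w by (simp add: weight_def suminf_mult[symmetric] summable_iff_shift del: add_Suc_right)
  finally have "prob {\<omega> \<in> space M. (\<kappa> + 1) * real N \<le> real (total N \<omega>)}
     \<le> (\<Sum>m<Suc N. weight N m * w m) + \<kappa>\<^sup>2 / real N + (\<Sum>m. weight N (m + Suc N) * w (m + Suc N))"
    by simp
  then show ?thesis using suminf_split_initial_segment[OF summable_weight[OF assms], of "Suc N"] by simp
qed

theorem linear_growth:
  "\<exists>C. AE \<omega> in M. eventually (\<lambda>n. real (total n \<omega>) \<le> C * real n) sequentially"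
proof -
  define A where "A k = {\<omega> \<in> space M. (\<kappa> + 1) * real (2 ^ k) \<le> real (total (2 ^ k) \<omega>)}" for k
  have [measurable]: "(\<lambda>\<omega>. real (total n \<omega>)) \<in> borel_measurable M" for n
  proof -
    have "(\<lambda>\<omega>. real (\<Delta> i \<omega>)) \<in> borel_measurable M" for i
      by (rule measurable_compose[OF measurable_\<Delta>]) simp
    then show ?thesis unfolding total_def of_nat_sum by measurable
  qed
  have A [measurable]: "A k \<in> sets M" for k unfolding A_def by measurable
  have "summable (\<lambda>k. prob (A k))"
  proof (rule summableI_nonneg_bounded)
    fix K
    have sumw: "summable (\<lambda>m. weight (2 ^ k) m * w m)" for k by (rule summable_weight) simp
    have "(\<Sum>k<K. prob (A k)) \<le> (\<Sum>k<K. (\<Sum>m. weight (2 ^ k) m * w m) + \<kappa>\<^sup>2 / real (2 ^ k))"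
      unfolding A_def by (intro sum_mono prob_total_large) simp
    \<comment> \<open>Exchanging the sums leaves, for each \<open>m\<close>, a dyadic sum of weights
      of at most 4m, so the finite mean gives summability.\<close>
    also have "\<dots> = (\<Sum>m. \<Sum>k<K. weight (2 ^ k) m * w m) + \<kappa>\<^sup>2 * (\<Sum>k<K. (1 / 2) ^ k)"
      using sumw by (simp add: sum.distrib suminf_sum sum_distrib_left power_divide)
    also have "(\<Sum>m. \<Sum>k<K. weight (2 ^ k) m * w m) \<le> (\<Sum>m. 4 * (real m * w m))"
    proof (rule suminf_le)
      fix m
      have "(\<Sum>k<K. weight (2 ^ k) m * w m) = (\<Sum>k<K. weight (2 ^ k) m) * w m" by (simp add: sum_distrib_right)
      also have "\<dots> \<le> (4 * real m) * w m"
        using dyadic_weight_sum[of m K] by (intro mult_right_mono w_nonneg) (simp add: weight_def)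
      finally show "(\<Sum>k<K. weight (2 ^ k) m * w m) \<le> 4 * (real m * w m)" by simp
    qed (use sumw summable_mean in \<open>auto intro!: summable_sum\<close>)
    also have "(\<Sum>k<K. (1 / 2) ^ k) \<le> (2::real)"
      using sum_le_suminf[of "\<lambda>k. (1 / 2) ^ k :: real" "{..<K}"] by (simp add: suminf_geometric)
    finally show "(\<Sum>k<K. prob (A k)) \<le> (\<Sum>m. 4 * (real m * w m)) + \<kappa>\<^sup>2 * 2"
      by (simp add: mult_left_mono)
  qed simp
  then have "AE \<omega> in M. eventually (\<lambda>k. \<omega> \<in> space M - A k) sequentially"
    by (intro borel_cantelli_AE1 A) (auto simp: emeasure_eq_measure)
  \<comment> \<open>\<open>total\<close> is nondecreasing in \<open>n\<close>, so control at powers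
    of 2 extends to all \<open>n\<close> at the cost of a factor 2.\<close>
  then have "AE \<omega> in M. eventually (\<lambda>n. real (total n \<omega>) \<le> (2 * (\<kappa> + 1)) * real n) sequentially"
  proof (rule AE_mp, intro AE_I2 impI)
    fix \<omega> assume "\<omega> \<in> space M" "eventually (\<lambda>k. \<omega> \<in> space M - A k) sequentially"
    then obtain k0 where k0: "\<And>k. k \<ge> k0 \<Longrightarrow> real (total (2 ^ k) \<omega>) \<le> (\<kappa> + 1) * real (2 ^ k)"
      by (auto simp: eventually_sequentially A_def not_le intro: less_imp_le)
    have "real (total n \<omega>) \<le> (2 * (\<kappa> + 1)) * real n" if n: "n \<ge> 2 ^ k0" for n
    proof -
      have "n \<ge> 1" using n by (meson one_le_power order_trans one_le_numeral)
      then obtain k where k: "2 ^ k \<le> n" "n < 2 ^ (k + 1)" using ex_power_ivl1[of 2 n] by auto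
      have "(2::nat) ^ k0 < 2 ^ (k + 1)" using n k(2) by linarith
      then have "k0 < k + 1" by (rule power_less_imp_less_exp[rotated]) simp
      then have "k0 \<le> k + 1" by simp
      have "real (total n \<omega>) \<le> real (total (2 ^ (k + 1)) \<omega>)"
        unfolding total_def of_nat_le_iff using k(2) by (intro sum_mono2) auto
      also have "\<dots> \<le> (\<kappa> + 1) * real (2 ^ (k + 1))" using \<open>k0 \<le> k + 1\<close> by (rule k0)
      also have "\<dots> = 2 * (\<kappa> + 1) * real (2 ^ k)" by simp
      also have "\<dots> \<le> 2 * (\<kappa> + 1) * real n"
        using k(1) \<kappa>_nonneg by (intro mult_left_mono) (simp_all only: of_nat_le_iff, simp)
      finally show ?thesis .
    qed
    then show "eventually (\<lambda>n. real (total n \<omega>) \<le> (2 * (\<kappa> + 1)) * real n) sequentially"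
      by (intro eventually_sequentiallyI[of "2 ^ k0"])
  qed
  then show ?thesis ..
qed

end

section \<open>The DLA process\<close>

text \<open>The diameter grows only if the new point becomes extremal, so the amount of growth
  leaves one possible position on each side.\<close>

lemma diam_increment:
  assumes "finite S" "a \<in> S" "0 < m" "nat (diam (S \<union> {x}) - diam S) = m"
  shows "x = Max S + int m \<or> x = Min S - int m"
proof -
  have "S \<noteq> {}" using assms(2) by auto
  then have "Max (S \<union> {x}) = max x (Max S)" "Min (S \<union> {x}) = min x (Min S)"
    using assms(1) by simp_all
  moreover have "Min S \<le> Max S" using assms(1,2) by (meson Max_ge Min_le order_trans)
  ultimately show ?thesis using assms(3,4) by (auto simp: diam_def max_def min_def split: if_splits)
qed

text \<open>Only the probabilities of \<open>A (Suc n) \<omega> = S n \<union> {x}\<close> with \<open>x \<notin> S n\<close> are prescribed; nothing else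
  happens because the gluing measure has total mass \<open>1\<close>.\<close>

lemma DLA_process_step:
  assumes DLA: "DLA_process p M A" and walk: "centered_walk p"
    and S: "finite (S n)" "a \<in> S n"
    and pos: "\<P>(\<omega> in M. \<forall>i\<le>n. A i \<omega> = S i) > 0"
  defines "E \<equiv> {\<omega> \<in> space M. \<forall>i\<le>n. A i \<omega> = S i}"
  shows "measure M {\<omega> \<in> E. \<forall>x. x \<notin> S n \<longrightarrow> A (Suc n) \<omega> \<noteq> S n \<union> {x}} = 0"
    and "\<And>x. x \<notin> S n \<Longrightarrow> measure M {\<omega> \<in> E. A (Suc n) \<omega> = S n \<union> {x}}
      = (\<Sum>a\<in>S n. gluing_measure p x a (S n)) * measure M E"
proof -
  interpret prob_space M using DLA by (simp add: DLA_process_def)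
  interpret centered_walk p by (rule walk)
  have meas [measurable]: "A i \<in> M \<rightarrow>\<^sub>M count_space {S. finite S}" for i
    using DLA by (simp add: DLA_process_def)
  have eq_sets: "{\<omega> \<in> space M. A i \<omega> = B} \<in> sets M" for i B
  proof (cases "finite B")
    case True
    have "A i -` {B} \<inter> space M \<in> sets M" using True by (intro measurable_sets[OF meas]) simp
    moreover have "A i -` {B} \<inter> space M = {\<omega> \<in> space M. A i \<omega> = B}" by auto
    ultimately show ?thesis by simp
  next
    case False
    then have "{\<omega> \<in> space M. A i \<omega> = B} = {}" using measurable_space[OF meas, of _ i] by auto
    then show ?thesis by (simp only: sets.empty_sets)
  qed
  have E_sets: "E \<in> sets M"
    unfolding E_def using sets.sets_Collect_finite_All[of "{..n}" M "\<lambda>i \<omega>. A i \<omega> = S i"] eq_sets by simp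
  have T_sets: "{\<omega> \<in> E. A (Suc n) \<omega> = B} \<in> sets M" for B
  proof -
    have "{\<omega> \<in> E. A (Suc n) \<omega> = B} = E \<inter> {\<omega> \<in> space M. A (Suc n) \<omega> = B}" by (auto simp: E_def)
    then show ?thesis using E_sets eq_sets by (simp add: sets.Int)
  qed
  have posE: "prob E > 0" using pos by (simp add: E_def)
  have "prob E \<le> prob {\<omega> \<in> space M. A n \<omega> = S n}"
    using eq_sets by (intro finite_measure_mono) (auto simp: E_def)
  with posE have pos_n: "\<P>(\<omega> in M. A n \<omega> = S n) > 0" by simp
  show step: "prob {\<omega> \<in> E. A (Suc n) \<omega> = S n \<union> {x}} = (\<Sum>a\<in>S n. gluing_measure p x a (S n)) * prob E"
    if "x \<notin> S n" for x
  proof -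
    have "\<P>(\<omega> in M. A (Suc n) \<omega> = S n \<union> {x} \<bar> \<forall>i\<le>n. A i \<omega> = S i)
        = \<P>(\<omega> in M. A (Suc n) \<omega> = S n \<union> {x} \<bar> A n \<omega> = S n)"
      using DLA pos unfolding DLA_process_def by blast
    also have "\<dots> = (\<Sum>a\<in>S n. gluing_measure p x a (S n))"
      using DLA pos_n S(1) that unfolding DLA_process_def by blast
    finally have "\<P>(\<omega> in M. A (Suc n) \<omega> = S n \<union> {x} \<and> (\<forall>i\<le>n. A i \<omega> = S i))
        = (\<Sum>a\<in>S n. gluing_measure p x a (S n)) * prob E"
      using posE by (simp add: cond_prob_def E_def field_simps)
    moreover have "{\<omega> \<in> E. A (Suc n) \<omega> = S n \<union> {x}}
        = {\<omega> \<in> space M. A (Suc n) \<omega> = S n \<union> {x} \<and> (\<forall>i\<le>n. A i \<omega> = S i)}"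
      by (auto simp: E_def)
    ultimately show ?thesis by simp
  qed
  \<comment> \<open>The gluing events of the single new points are disjoint, and their probabilities
    add up to that of \<open>E\<close>, so together they exhaust \<open>E\<close> up to a null
    set.\<close>
  define G where "G k = (if int_decode k \<in> S n then {} else {\<omega> \<in> E. A (Suc n) \<omega> = S n \<union> {int_decode k}})" for k
  have G_sets: "G k \<in> sets M" for k using T_sets by (simp add: G_def)
  have "disjoint_family G"
  proof (unfold disjoint_family_on_def, intro ballI impI)
    fix j k :: nat assume "j \<noteq> k"
    then have "int_decode j \<noteq> int_decode k" by (simp add: inj_eq[OF inj_int_decode])
    then show "G j \<inter> G k = {}" by (auto simp: G_def)
  qed
  then have "(\<lambda>k. prob (G k)) sums prob (\<Union>k. G k)"
    using G_sets by (intro finite_measure_UNION) auto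
  moreover have "prob (G k) = (if int_decode k \<in> S n then 0
      else \<Sum>a\<in>S n. gluing_measure p (int_decode k) a (S n)) * prob E" for k
    by (simp add: G_def step del: Un_insert_right)
  then have "(\<lambda>k. prob (G k)) sums (1 * prob E)"
    using sums_mult2[OF gluing_measure_sums_1[OF S bij_int_decode], of "prob E"] by simp
  ultimately have "prob (\<Union>k. G k) = prob E" by (simp add: sums_iff)
  moreover have "(\<Union>k. G k) \<subseteq> E" by (auto simp: G_def split: if_splits)
  ultimately have "prob (E - (\<Union>k. G k)) = 0"
    using E_sets G_sets by (subst finite_measure_Diff) auto
  moreover have "{\<omega> \<in> E. \<forall>x. x \<notin> S n \<longrightarrow> A (Suc n) \<omega> \<noteq> S n \<union> {x}} = E - (\<Union>k. G k)"
  proof (intro equalityI subsetI)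
    fix \<omega> assume \<omega>: "\<omega> \<in> E - (\<Union>k. G k)"
    have "A (Suc n) \<omega> \<noteq> S n \<union> {x}" if "x \<notin> S n" for x
    proof -
      have "\<omega> \<notin> G (int_encode x)" using \<omega> by blast
      then show ?thesis using \<omega> that by (simp add: G_def)
    qed
    then show "\<omega> \<in> {\<omega> \<in> E. \<forall>x. x \<notin> S n \<longrightarrow> A (Suc n) \<omega> \<noteq> S n \<union> {x}}" using \<omega> by blast
  qed (auto simp: G_def split: if_splits)
  ultimately show "prob {\<omega> \<in> E. \<forall>x. x \<notin> S n \<longrightarrow> A (Suc n) \<omega> \<noteq> S n \<union> {x}} = 0" by simp
qed

text \<open>Keeps the cluster nonempty, as its maximum, its minimum and the total mass of the gluing
  measure require.\<close>

lemma DLA_process_contains_0: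
  assumes "DLA_process p M A"
  shows "AE \<omega> in M. \<forall>n. 0 \<in> A n \<omega>"
proof -
  have "AE \<omega> in M. A 0 \<omega> = {0}" "AE \<omega> in M. \<forall>n. A n \<omega> \<subseteq> A (Suc n) \<omega>"
    using assms by (auto simp: DLA_process_def)
  then show ?thesis
  proof eventually_elim
    case (elim \<omega>)
    show ?case
    proof
      fix n show "0 \<in> A n \<omega>" using elim by (induction n) auto
    qed
  qed
qed

text \<open>Histories are encoded as lists of sorted lists: a countable type, as the growth argument
  requires, from which the finite sets can be recovered.\<close>

lemma DLA_process_dominated_increments:
  assumes DLA: "DLA_process p M A" and walk: "centered_walk p"
    and moment: "integrable (measure_pmf p) (\<lambda>k. \<bar>real_of_int k\<bar> ^ 3)"
  defines "H \<equiv> \<lambda>n \<omega>. map (\<lambda>i. sorted_list_of_set (A i \<omega>)) [0..<Suc n]"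
  shows "\<exists>w. dominated_increments M H (\<lambda>n \<omega>. nat (diam (A (Suc n) \<omega>) - diam (A n \<omega>)))
    (\<lambda>i h. nat (diam (set (h ! Suc i)) - diam (set (h ! i)))) w"
proof -
  interpret prob_space M using DLA by (simp add: DLA_process_def)
  interpret centered_walk p by (rule walk)
  obtain C where C: "C > 0" and gluing: "\<forall>S x a. finite S \<longrightarrow> x \<notin> S \<longrightarrow> a \<in> S \<longrightarrow> (\<forall>b\<in>S. \<bar>x - a\<bar> \<le> \<bar>x - b\<bar>) \<longrightarrow>
    (\<Sum>a\<in>S. gluing_measure p x a S)
      \<le> C * real_of_int \<bar>x - a\<bar> * measure_pmf.prob p {k. \<bar>x - a\<bar> \<le> \<bar>k\<bar>}"
    using gluing_measure_bound by blast
  define v where "v m = C * real m * measure_pmf.prob p {k. int m \<le> \<bar>k\<bar>}" for m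
  have v0: "0 \<le> v m" for m using C by (simp add: v_def)
  define D where "D n \<omega> = nat (diam (A (Suc n) \<omega>) - diam (A n \<omega>))" for n \<omega>
  have meas: "A i \<in> M \<rightarrow>\<^sub>M count_space {S. finite S}" for i
    using DLA by (simp add: DLA_process_def)
  have fin: "finite (A i \<omega>)" if "\<omega> \<in> space M" for i \<omega>
    using measurable_space[OF meas that, of i] by simp
  have list_meas [measurable]: "(\<lambda>\<omega>. sorted_list_of_set (A i \<omega>)) \<in> M \<rightarrow>\<^sub>M count_space UNIV" for i
    by (rule measurable_compose[OF meas]) simp
  have H_meas [measurable]: "H n \<in> M \<rightarrow>\<^sub>M count_space UNIV" for n
  proof -
    have "{\<omega> \<in> space M. length h = Suc n \<and> (\<forall>i\<in>{..<Suc n}. sorted_list_of_set (A i \<omega>) = h ! i)} \<in> sets M" for h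
      by measurable
    moreover have "H n -` {h} \<inter> space M
        = {\<omega> \<in> space M. length h = Suc n \<and> (\<forall>i\<in>{..<Suc n}. sorted_list_of_set (A i \<omega>) = h ! i)}" for h
      by (auto simp: H_def list_eq_iff_nth_eq simp del: upt_Suc)
    ultimately show ?thesis by (simp add: measurable_count_space_eq2_countable)
  qed
  have H_nth: "set (H n \<omega> ! i) = A i \<omega>" if "i \<le> n" "\<omega> \<in> space M" for i n \<omega>
    using that fin by (simp add: H_def nth_append del: upt_Suc)
  \<comment> \<open>The factor 2 accounts for growth at either end of the cluster.\<close>
  have "dominated_increments M H D (\<lambda>i h. nat (diam (set (h ! Suc i)) - diam (set (h ! i)))) (\<lambda>m. 2 * v m)"
  proof (unfold_locales)
    show "H n \<in> M \<rightarrow>\<^sub>M count_space UNIV" for n by (rule H_meas)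
    show adapted: "D i \<omega> = nat (diam (set (H n \<omega> ! Suc i)) - diam (set (H n \<omega> ! i)))"
      if "i < n" "\<omega> \<in> space M" for i n \<omega>
      using that by (simp add: D_def H_nth)
    show "D n \<in> M \<rightarrow>\<^sub>M count_space UNIV" for n
    proof -
      have "(\<lambda>\<omega>. nat (diam (set (H (Suc n) \<omega> ! Suc n)) - diam (set (H (Suc n) \<omega> ! n)))) \<in> M \<rightarrow>\<^sub>M count_space UNIV"
        by (rule measurable_compose[OF H_meas]) simp
      then show ?thesis by (rule measurable_cong[THEN iffD1, rotated]) (simp add: D_def H_nth)
    qed
    show "0 \<le> 2 * v m" for m using v0[of m] by simp
    \<comment> \<open>The third moment enters here: one factor m stems from the escape bound, the
      other from taking the mean.\<close>
    have "summable (\<lambda>m. 2 * C * (real m ^ 2 * measure_pmf.prob p {k. int m \<le> \<bar>k\<bar>}))"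
      using moment by (intro summable_mult summable_tail_prob) (simp_all add: numeral_3_eq_3 numeral_2_eq_2)
    then show "summable (\<lambda>m. real m * (2 * v m))" by (simp add: v_def power2_eq_square mult_ac)
    fix n m h
    assume m: "0 < (m::nat)"
    let ?E = "{\<omega> \<in> space M. H n \<omega> = h}"
    show "prob {\<omega> \<in> space M. H n \<omega> = h \<and> D n \<omega> = m} \<le> 2 * v m * prob ?E"
    proof (cases "prob ?E = 0")
      case True
      have "prob {\<omega> \<in> space M. H n \<omega> = h \<and> D n \<omega> = m} \<le> prob ?E"
        by (rule finite_measure_mono) auto
      then show ?thesis using True by simp
    next
      case False
      \<comment> \<open>An atom of positive probability meets the almost sure event that 0 lies in
        the cluster; an outcome in both represents the history by concrete finite sets.\<close>
      have "\<not> (AE \<omega> in M. \<omega> \<notin> ?E)"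
        using False by (subst AE_iff_measurable[of ?E]) (auto simp: emeasure_eq_measure)
      moreover have "AE \<omega> in M. \<omega> \<notin> ?E" if "\<forall>\<omega>\<in>?E. 0 \<notin> A n \<omega>"
        using DLA_process_contains_0[OF DLA] by eventually_elim (use that in blast)
      ultimately obtain \<omega>0 where \<omega>0: "\<omega>0 \<in> ?E" "0 \<in> A n \<omega>0" by blast
      define S where "S i = A i \<omega>0" for i
      have S: "finite (S n)" "0 \<in> S n" using \<omega>0 fin by (auto simp: S_def)
      have E_eq: "?E = {\<omega> \<in> space M. \<forall>i\<le>n. A i \<omega> = S i}"
      proof (intro equalityI subsetI)
        fix \<omega> assume \<omega>: "\<omega> \<in> ?E"
        then have "A i \<omega> = S i" if "i \<le> n" for i
          using H_nth[OF that, of \<omega>] H_nth[OF that, of \<omega>0] \<omega>0(1) by (simp add: S_def)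
        with \<omega> show "\<omega> \<in> {\<omega> \<in> space M. \<forall>i\<le>n. A i \<omega> = S i}" by simp
      next
        fix \<omega> assume \<omega>: "\<omega> \<in> {\<omega> \<in> space M. \<forall>i\<le>n. A i \<omega> = S i}"
        then have "H n \<omega> = H n \<omega>0" unfolding H_def by (intro map_cong) (auto simp: S_def)
        with \<omega> \<omega>0 show "\<omega> \<in> ?E" by simp
      qed
      then have pos: "\<P>(\<omega> in M. \<forall>i\<le>n. A i \<omega> = S i) > 0"
        using False by (metis measure_nonneg order_le_less)
      note step = DLA_process_step[OF DLA walk S pos, folded E_eq]
      define x1 where "x1 = Max (S n) + int m"
      define x2 where "x2 = Min (S n) - int m"
      let ?T = "\<lambda>x. {\<omega> \<in> ?E. A (Suc n) \<omega> = S n \<union> {x}}"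
      have A_sets: "{\<omega> \<in> space M. A (Suc n) \<omega> = B} \<in> sets M" if "finite B" for B
      proof -
        have "A (Suc n) -` {B} \<inter> space M \<in> sets M" using that by (intro measurable_sets[OF meas]) simp
        moreover have "A (Suc n) -` {B} \<inter> space M = {\<omega> \<in> space M. A (Suc n) \<omega> = B}" by auto
        ultimately show ?thesis by simp
      qed
      have T_sets: "?T x \<in> sets M" for x
      proof -
        have "?T x = ?E \<inter> {\<omega> \<in> space M. A (Suc n) \<omega> = S n \<union> {x}}" by auto
        also have "\<dots> \<in> sets M" using A_sets[of "S n \<union> {x}"] S by (intro sets.Int) auto
        finally show ?thesis .
      qed
      let ?N = "{\<omega> \<in> ?E. \<forall>x. x \<notin> S n \<longrightarrow> A (Suc n) \<omega> \<noteq> S n \<union> {x}}"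
      have N_sets: "?N \<in> sets M"
      proof -
        have "?N = ?E - (\<Union>x\<in>- S n. ?T x)" by auto
        also have "\<dots> \<in> sets M" using T_sets by (intro sets.Diff sets.countable_UN'') auto
        finally show ?thesis .
      qed
      have bound: "prob (?T x) \<le> v m * prob ?E"
        if "x \<notin> S n" "a \<in> S n" "\<forall>b\<in>S n. \<bar>x - a\<bar> \<le> \<bar>x - b\<bar>" "\<bar>x - a\<bar> = int m" for x a
      proof -
        have "(\<Sum>a\<in>S n. gluing_measure p x a (S n)) \<le> v m"
          using gluing[rule_format, OF S(1) that(1,2)] that(3,4) by (simp add: v_def)
        then show ?thesis using step(2)[OF that(1)] by (simp add: mult_right_mono)
      qed
      have x1: "x1 \<notin> S n" "\<forall>b\<in>S n. \<bar>x1 - Max (S n)\<bar> \<le> \<bar>x1 - b\<bar>" "\<bar>x1 - Max (S n)\<bar> = int m"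
      proof -
        have le: "b \<le> Max (S n)" if "b \<in> S n" for b using S(1) that by (rule Max_ge)
        show "x1 \<notin> S n" using le[of x1] m by (auto simp: x1_def)
        show "\<forall>b\<in>S n. \<bar>x1 - Max (S n)\<bar> \<le> \<bar>x1 - b\<bar>"
        proof
          fix b assume "b \<in> S n"
          then show "\<bar>x1 - Max (S n)\<bar> \<le> \<bar>x1 - b\<bar>" using le[of b] by (simp add: x1_def)
        qed
      qed (simp add: x1_def)
      have x2: "x2 \<notin> S n" "\<forall>b\<in>S n. \<bar>x2 - Min (S n)\<bar> \<le> \<bar>x2 - b\<bar>" "\<bar>x2 - Min (S n)\<bar> = int m"
      proof -
        have le: "Min (S n) \<le> b" if "b \<in> S n" for b using S(1) that by (rule Min_le)
        show "x2 \<notin> S n" using le[of x2] m by (auto simp: x2_def)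
        show "\<forall>b\<in>S n. \<bar>x2 - Min (S n)\<bar> \<le> \<bar>x2 - b\<bar>"
        proof
          fix b assume "b \<in> S n"
          then show "\<bar>x2 - Min (S n)\<bar> \<le> \<bar>x2 - b\<bar>" using le[of b] by (simp add: x2_def)
        qed
      qed (simp add: x2_def)
      have ne: "S n \<noteq> {}" using S by auto
      have "{\<omega> \<in> space M. H n \<omega> = h \<and> D n \<omega> = m} \<subseteq> ?N \<union> (?T x1 \<union> ?T x2)"
      proof
        fix \<omega> assume \<omega>: "\<omega> \<in> {\<omega> \<in> space M. H n \<omega> = h \<and> D n \<omega> = m}"
        show "\<omega> \<in> ?N \<union> (?T x1 \<union> ?T x2)"
        proof (cases "\<exists>x. x \<notin> S n \<and> A (Suc n) \<omega> = S n \<union> {x}")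
          case True
          then obtain x where x: "A (Suc n) \<omega> = S n \<union> {x}" by blast
          moreover have "A n \<omega> = S n" using \<omega> E_eq by blast
          ultimately have "x = x1 \<or> x = x2"
            using \<omega> diam_increment[OF S m, of x] by (simp add: D_def x1_def x2_def)
          then show ?thesis using \<omega> x by auto
        qed (use \<omega> in blast)
      qed
      then have "prob {\<omega> \<in> space M. H n \<omega> = h \<and> D n \<omega> = m} \<le> prob (?N \<union> (?T x1 \<union> ?T x2))"
        using N_sets T_sets by (intro finite_measure_mono sets.Un)
      also have "\<dots> \<le> prob ?N + prob (?T x1 \<union> ?T x2)"
        using N_sets T_sets by (intro measure_Un_le sets.Un)
      also have "prob (?T x1 \<union> ?T x2) \<le> prob (?T x1) + prob (?T x2)"
        using T_sets by (intro measure_Un_le)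
      also have "prob (?T x1) \<le> v m * prob ?E"
        using bound[OF x1(1) Max_in[OF S(1) ne] x1(2,3)] .
      also have "prob (?T x2) \<le> v m * prob ?E"
        using bound[OF x2(1) Min_in[OF S(1) ne] x2(2,3)] .
      finally show ?thesis using step(1) by (simp add: algebra_simps)
    qed
  qed
  then show ?thesis unfolding D_def[abs_def] by blast
qed

theorem theorem4p1:
  fixes p :: "int pmf" and M :: "'w measure" and A :: "nat \<Rightarrow> 'w \<Rightarrow> int set"
  assumes "aperiodic_walk p"
    and "integrable (measure_pmf p) (\<lambda>k. \<bar>real_of_int k\<bar> ^ 3)"
    and "measure_pmf.expectation p real_of_int = 0"
    and "DLA_process p M A"
  shows "\<exists>C :: real. AE \<omega> in M.
           limsup (\<lambda>n. ereal (real_of_int (diam (A n \<omega>)) / real n)) < ereal C"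
proof -
  have walk: "centered_walk p"
  proof
    show "\<exists>xs. set xs \<subseteq> set_pmf p \<and> sum_list xs = y" for y
      by (rule aperiodic_walk_irreducible) (rule assms(1))
    show "integrable (measure_pmf p) (\<lambda>k. (real_of_int k)\<^sup>2)"
    proof (rule Bochner_Integration.integrable_bound[OF assms(2)])
      show "AE k in measure_pmf p. norm ((real_of_int k)\<^sup>2) \<le> norm (\<bar>real_of_int k\<bar> ^ 3)"
      proof (intro AE_I2)
        fix k :: int
        have "\<bar>real_of_int k\<bar> ^ 2 \<le> \<bar>real_of_int k\<bar> ^ 3"
        proof (cases "k = 0")
          case False
          then have "1 \<le> \<bar>real_of_int k\<bar>" by linarith
          then show ?thesis by (rule power_increasing[rotated]) simp
        qed simp
        then show "norm ((real_of_int k)\<^sup>2) \<le> norm (\<bar>real_of_int k\<bar> ^ 3)" by simp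
      qed
    qed simp
  qed (rule assms(3))
  obtain w where "dominated_increments M (\<lambda>n \<omega>. map (\<lambda>i. sorted_list_of_set (A i \<omega>)) [0..<Suc n])
      (\<lambda>n \<omega>. nat (diam (A (Suc n) \<omega>) - diam (A n \<omega>)))
      (\<lambda>i h. nat (diam (set (h ! Suc i)) - diam (set (h ! i)))) w"
    using DLA_process_dominated_increments[OF assms(4) walk assms(2)] by blast
  then interpret dominated_increments M "\<lambda>n \<omega>. map (\<lambda>i. sorted_list_of_set (A i \<omega>)) [0..<Suc n]"
    "\<lambda>n \<omega>. nat (diam (A (Suc n) \<omega>) - diam (A n \<omega>))"
    "\<lambda>i h. nat (diam (set (h ! Suc i)) - diam (set (h ! i)))" w .
  obtain C where "AE \<omega> in M. eventually (\<lambda>n. real (total n \<omega>) \<le> C * real n) sequentially"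
    using linear_growth by blast
  moreover have "AE \<omega> in M. A 0 \<omega> = {0}" using assms(4) by (simp add: DLA_process_def)
  \<comment> \<open>The added 1 makes the inequality strict.\<close>
  ultimately have "AE \<omega> in M. limsup (\<lambda>n. ereal (real_of_int (diam (A n \<omega>)) / real n)) < ereal (C + 1)"
  proof eventually_elim
    case (elim \<omega>)
    \<comment> \<open>The \<open>nat\<close> in the increments discards only negative changes, so
      their sum dominates the diameter.\<close>
    have le: "diam (A n \<omega>) \<le> int (total n \<omega>)" for n
    proof (induction n)
      case 0
      then show ?case using elim(2) by (simp add: diam_def total_def)
    qed (simp add: total_def)
    have "eventually (\<lambda>n. ereal (real_of_int (diam (A n \<omega>)) / real n) \<le> ereal C) sequentially"
      using elim(1) eventually_gt_at_top[of 0]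
    proof eventually_elim
      case (elim n)
      have "real_of_int (diam (A n \<omega>)) \<le> real_of_int (int (total n \<omega>))"
        unfolding of_int_le_iff by (rule le)
      then show ?case using elim by (simp add: divide_le_eq)
    qed
    then have "limsup (\<lambda>n. ereal (real_of_int (diam (A n \<omega>)) / real n)) \<le> ereal C"
      by (rule Limsup_bounded)
    also have "\<dots> < ereal (C + 1)" by simp
    finally show ?case .
  qed
  then show ?thesis ..
qed

end
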